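(* Let $f:\mathbb{R}^N\to\mathbb{R}^N$ be the piecewise-linear continuous map with switching manifold $\Sigma$ given in the context, and let $\mathcal{X}$ and $\mathcal{Y}$ be words in $\{L,R\}$ of lengths $n$ and $p$. Suppose: (i) $\mathcal{X}\mathcal{Y} = (\mathcal{Y}\mathcal{X})^{\overline{0}\,\overline{\alpha}}$ for some $\alpha\in\{1,\ldots,n+p-1\}$; (ii) $M_{\mathcal{X}}$ has eigenvalues $\lambda_1,\lambda_2$ of multiplicity one such that, with $\beta$ denoting the maximum modulus of the remaining eigenvalues of $M_{\mathcal{X}}$, $0\le\beta<\lambda_2<1<\lambda_1$; and $e_1^{\mathsf T}\zeta_1\neq 0$; (iii) $\lambda_1\lambda_2=1$ and $\lambda_2<c<1$, where $$c=\det\left(\begin{bmatrix}\omega_1^{\mathsf T}\\ \omega_2^{\mathsf T}\end{bmatrix} M_{\mathcal{Y}}\begin{bmatrix}\zeta_1 & \zeta_2\end{bmatrix}\right);$$ (iv) the $\mathcal{X}$-cycle $\{x_i^{\mathcal{X}}\}$ is admissible with no points on $\Sigma$; (v) there exists an admissible $\mathcal{S}$-orbit $\{y_i\}_{i\in\mathbb{Z}}$, where $\mathcal{S}=\mathcal{X}^\infty\mathcal{Y}\mathcal{X}^\infty$, that is homoclinic to the $\mathcal{X}$-cycle and with $y_0=E^u(x_0^{\mathcal{X}})\cap\Sigma$ and $y_\alpha\in\Sigma$; (vi) there does not exist $i\ge 0$ such that $y_i\in\Sigma$ and $y_{i+n}\in\Sigma$. Then there exists $k_{\min}\ge 0$ such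 that for all $k\ge k_{\min}$ the map $f$ has an admissible, asymptotically stable $\mathcal{X}^k\mathcal{Y}$-cycle with no points on $\Sigma$.
   Context: **The map.** $f(x)=f_L(x)=A_Lx+b$ if $e_1^{\mathsf T}x\le 0$ and $f(x)=f_R(x)=A_Rx+b$ if $e_1^{\mathsf T}x\ge 0$, where $A_L,A_R$ are real $N\times N$ matrices, $b\in\mathbb{R}^N$, $e_i$ is the $i$-th coordinate vector of $\mathbb{R}^N$, and $A_R=A_L+\xi e_1^{\mathsf T}$ for some $\xi\in\mathbb{R}^N$ (so $f$ is continuous). $\Sigma=\{x\in\mathbb{R}^N: e_1^{\mathsf T}x=0\}$. **Words.** A word of length $m$ is $\mathcal{Z}=\mathcal{Z}_0\cdots\mathcal{Z}_{m-1}$ with $\mathcal{Z}_i\in\{L,R\}$. Juxtaposition is concatenation, and $\mathcal{X}^k\mathcal{Y}$ is $k$ copies of $\mathcal{X}$ followed by $\mathcal{Y}$. $\mathcal{Z}^{\overline{i}}$ is $\mathcal{Z}$ with the symbol $\mathcal{Z}_i$ flipped ($L\leftrightarrow R$); $\mathcal{Z}^{\overline{i}\,\overline{j}}$ is $\mathcal{Z}$ with the symbols at indices $i$ and $j$ flipped. **Compositions.** For a word $\mathcal{Z}$ of length $m$: $f_{\mathcal{Z}}=f_{\mathcal{Z}_{m-1}}\circ\cdots\circ f_{\mathcal{Z}_0}$ and $M_{\mathcal{Z}}=A_{\mathcal{Z}_{m-1}}\cdots A_{\mathcal{Z}_0}$ (the linear part of the affine map $f_{\mathcal{Z}}$). **Following,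 cycles.** With $x_{i+1}=f(x_i)$, a point $x_0$ follows $\mathcal{Z}$ under $f$ if for all $i=0,\ldots,m-1$: $\mathcal{Z}_i=L$ whenever $e_1^{\mathsf T}x_i<0$, and $\mathcal{Z}_i=R$ whenever $e_1^{\mathsf T}x_i>0$. A $\mathcal{Z}$-cycle is an $m$-tuple $\{x_i^{\mathcal{Z}}\}_{i=0}^{m-1}$ with $f_{\mathcal{Z}_i}(x_i^{\mathcal{Z}})=x_{(i+1)\bmod m}^{\mathcal{Z}}$ for all $i$. It is admissible if $x_0^{\mathcal{Z}}$ follows $\mathcal{Z}$ under $f$ (then it is a periodic orbit of $f$). It is unique if $1$ is not an eigenvalue of $M_{\mathcal{Z}}$. An admissible $\mathcal{Z}$-cycle with no points on $\Sigma$ is asymptotically stable (as a periodic solution of $f$) if and only if all eigenvalues of $M_{\mathcal{Z}}$ have modulus strictly less than $1$. **Orbits.** $\mathcal{S}=\mathcal{X}^\infty\mathcal{Y}\mathcal{X}^\infty$ is the bi-infinite sequence with $\mathcal{S}_i=\mathcal{X}_{i\bmod n}$ for $i<0$, $\mathcal{S}_i=\mathcal{Y}_i$ for $0\le i\le p-1$, $\mathcal{S}_i=\mathcal{X}_{(i-p)\bmod n}$ for $i\ge p$, where $i\bmod n\in\{0,\ldots,n-1\}$. An $\mathcal{S}$-orbit is a sequence $\{y_i\}_{i\in\mathbb{Z}}$ with $y_{i+1}=f_{\mathcal{S}_i}(y_i)$ for all $i\in\mathbb{Z}$. It is admissible if for all $i\in\mathbb{Z}$: $\mathcal{S}_i=L$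 whenever $e_1^{\mathsf T}y_i<0$ and $\mathcal{S}_i=R$ whenever $e_1^{\mathsf T}y_i>0$. It is homoclinic to the $\mathcal{X}$-cycle if $y_i$ converges to the $\mathcal{X}$-cycle (distance to the set of its points tends to $0$) as $i\to\infty$ and as $i\to-\infty$. **Eigenvectors and invariant subspaces.** For $i=1,2$, $\omega_i^{\mathsf T}$ and $\zeta_i$ are (real) left and right eigenvectors of $M_{\mathcal{X}}$ for $\lambda_i$, normalised so that $\omega_i^{\mathsf T}\zeta_i=1$. If $N=2$, $\beta=0$. $E^u(x_0^{\mathcal{X}})$ and $E^s(x_0^{\mathcal{X}})$ are the unstable and stable manifolds of the fixed point $x_0^{\mathcal{X}}$ of the affine map $f_{\mathcal{X}}$; under the eigenvalue condition these are the line $\{x_0^{\mathcal{X}}+a\zeta_1: a\in\mathbb{R}\}$ and the hyperplane $\{x:\omega_1^{\mathsf T}(x-x_0^{\mathcal{X}})=0\}$. Since $e_1^{\mathsf T}\zeta_1\ne0$, $E^u(x_0^{\mathcal{X}})\cap\Sigma$ is a single point. *)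

theory Defs
  imports "HOL-Analysis.Analysis" "HOL-Computational_Algebra.Polynomial"
begin

text \<open>
  Points live in \<open>real ^ 'n\<close>. A finite index type has no distinguished first element, so the
  index called ``first'' is a parameter \<open>i1\<close>: \<open>x $ i1\<close> is \<open>e\<^sub>1\<^sup>T x\<close> and \<open>axis i1 1\<close> is \<open>e\<^sub>1\<close>.
\<close>

definition switching_manifold :: "'n \<Rightarrow> (real ^ 'n::finite) set" where
  "switching_manifold i1 = {x. x $ i1 = 0}"

datatype letter = L | R

fun flip :: "letter \<Rightarrow> letter" where
  "flip L = R"
| "flip R = L"

definition flip_at :: "nat \<Rightarrow> letter list \<Rightarrow> letter list" where
  "flip_at i Z = Z[i := flip (Z ! i)]"

definition word_power :: "letter list \<Rightarrow> nat \<Rightarrow> letter list" where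
  "word_power X k = concat (replicate k X)"

definition letter_matrix ::
    "real ^ 'n ^ 'n \<Rightarrow> real ^ 'n ^ 'n \<Rightarrow> letter \<Rightarrow> real ^ 'n::finite ^ 'n" where
  "letter_matrix A_L A_R s = (case s of L \<Rightarrow> A_L | R \<Rightarrow> A_R)"

definition letter_map ::
    "real ^ 'n ^ 'n \<Rightarrow> real ^ 'n ^ 'n \<Rightarrow> real ^ 'n \<Rightarrow> letter \<Rightarrow> real ^ 'n \<Rightarrow> real ^ 'n::finite" where
  "letter_map A_L A_R b s x = letter_matrix A_L A_R s *v x + b"

text \<open>
  The two pieces agree on the switching manifold when \<open>A_R = A_L + \<xi> e\<^sub>1\<^sup>T\<close>, so it does not matter
  that the boundary is assigned to the left piece.
\<close>
definition pwl_map ::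
    "'n \<Rightarrow> real ^ 'n ^ 'n \<Rightarrow> real ^ 'n ^ 'n \<Rightarrow> real ^ 'n \<Rightarrow> real ^ 'n \<Rightarrow> real ^ 'n::finite" where
  "pwl_map i1 A_L A_R b x = (if x $ i1 \<le> 0 then letter_map A_L A_R b L x else letter_map A_L A_R b R x)"

text \<open>The first letter of a word acts first, i.e. its factor stands rightmost.\<close>

primrec word_map ::
    "real ^ 'n ^ 'n \<Rightarrow> real ^ 'n ^ 'n \<Rightarrow> real ^ 'n \<Rightarrow> letter list \<Rightarrow> real ^ 'n \<Rightarrow> real ^ 'n::finite" where
  "word_map A_L A_R b [] = id"
| "word_map A_L A_R b (s # Z) = word_map A_L A_R b Z \<circ> letter_map A_L A_R b s"

primrec word_matrix ::
    "real ^ 'n ^ 'n \<Rightarrow> real ^ 'n ^ 'n \<Rightarrow> letter list \<Rightarrow> real ^ 'n::finite ^ 'n" where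
  "word_matrix A_L A_R [] = mat 1"
| "word_matrix A_L A_R (s # Z) = word_matrix A_L A_R Z ** letter_matrix A_L A_R s"

definition agrees_with_sign :: "'n \<Rightarrow> letter \<Rightarrow> real ^ 'n::finite \<Rightarrow> bool" where
  "agrees_with_sign i1 s x \<longleftrightarrow> (x $ i1 < 0 \<longrightarrow> s = L) \<and> (x $ i1 > 0 \<longrightarrow> s = R)"

definition follows ::
    "'n \<Rightarrow> real ^ 'n ^ 'n \<Rightarrow> real ^ 'n ^ 'n \<Rightarrow> real ^ 'n \<Rightarrow> letter list \<Rightarrow> real ^ 'n::finite \<Rightarrow> bool" where
  "follows i1 A_L A_R b Z x0 \<longleftrightarrow>
     (\<forall>i<length Z. agrees_with_sign i1 (Z ! i) ((pwl_map i1 A_L A_R b ^^ i) x0))"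

text \<open>Of a cycle \<open>x\<close>, only the values \<open>x i\<close> with \<open>i < length Z\<close> are relevant.\<close>

definition is_cycle ::
    "real ^ 'n ^ 'n \<Rightarrow> real ^ 'n ^ 'n \<Rightarrow> real ^ 'n \<Rightarrow> letter list \<Rightarrow> (nat \<Rightarrow> real ^ 'n::finite) \<Rightarrow> bool" where
  "is_cycle A_L A_R b Z x \<longleftrightarrow>
     (\<forall>i<length Z. letter_map A_L A_R b (Z ! i) (x i) = x ((i + 1) mod length Z))"

definition admissible_cycle ::
    "'n \<Rightarrow> real ^ 'n ^ 'n \<Rightarrow> real ^ 'n ^ 'n \<Rightarrow> real ^ 'n \<Rightarrow> letter list \<Rightarrow>
      (nat \<Rightarrow> real ^ 'n::finite) \<Rightarrow> bool" where
  "admissible_cycle i1 A_L A_R b Z x \<longleftrightarrow> is_cycle A_L A_R b Z x \<and> follows i1 A_L A_R b Z (x 0)"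

definition cycle_points :: "letter list \<Rightarrow> (nat \<Rightarrow> 'a) \<Rightarrow> 'a set" where
  "cycle_points Z x = x ` {..<length Z}"

text \<open>Lyapunov stability plus attraction of the forward solution of \<open>f\<close> starting at \<open>x0\<close>.\<close>

definition asymptotically_stable :: "('a::metric_space \<Rightarrow> 'a) \<Rightarrow> 'a \<Rightarrow> bool" where
  "asymptotically_stable f x0 \<longleftrightarrow>
     (\<forall>\<epsilon>>0. \<exists>\<delta>>0. \<forall>u. dist u x0 < \<delta> \<longrightarrow> (\<forall>j. dist ((f ^^ j) u) ((f ^^ j) x0) < \<epsilon>)) \<and>
     (\<exists>\<delta>>0. \<forall>u. dist u x0 < \<delta> \<longrightarrow> (\<lambda>j. dist ((f ^^ j) u) ((f ^^ j) x0)) \<longlonglongrightarrow> 0)"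

text \<open>The bi-infinite sequence \<open>X\<^sup>\<infinity> Y X\<^sup>\<infinity>\<close>, with the block \<open>Y\<close> starting at index 0.\<close>

definition homoclinic_sequence :: "letter list \<Rightarrow> letter list \<Rightarrow> int \<Rightarrow> letter" where
  "homoclinic_sequence X Y i =
     (if i < 0 then X ! nat (i mod int (length X))
      else if i < int (length Y) then Y ! nat i
      else X ! nat ((i - int (length Y)) mod int (length X)))"

definition is_orbit ::
    "real ^ 'n ^ 'n \<Rightarrow> real ^ 'n ^ 'n \<Rightarrow> real ^ 'n \<Rightarrow> (int \<Rightarrow> letter) \<Rightarrow>
      (int \<Rightarrow> real ^ 'n::finite) \<Rightarrow> bool" where
  "is_orbit A_L A_R b S y \<longleftrightarrow> (\<forall>i. y (i + 1) = letter_map A_L A_R b (S i) (y i))"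

definition admissible_orbit ::
    "'n \<Rightarrow> real ^ 'n ^ 'n \<Rightarrow> real ^ 'n ^ 'n \<Rightarrow> real ^ 'n \<Rightarrow> (int \<Rightarrow> letter) \<Rightarrow>
      (int \<Rightarrow> real ^ 'n::finite) \<Rightarrow> bool" where
  "admissible_orbit i1 A_L A_R b S y \<longleftrightarrow>
     is_orbit A_L A_R b S y \<and> (\<forall>i. agrees_with_sign i1 (S i) (y i))"

definition homoclinic_to :: "'a::metric_space set \<Rightarrow> (int \<Rightarrow> 'a) \<Rightarrow> bool" where
  "homoclinic_to C y \<longleftrightarrow>
     ((\<lambda>i. infdist (y i) C) \<longlongrightarrow> 0) at_top \<and> ((\<lambda>i. infdist (y i) C) \<longlongrightarrow> 0) at_bot"

text \<open>
  Points with a backward \<open>g\<close>-orbit converging to \<open>x0\<close>; \<open>g\<close> is not assumed invertible.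
\<close>
definition unstable_manifold :: "('a::topological_space \<Rightarrow> 'a) \<Rightarrow> 'a \<Rightarrow> 'a set" where
  "unstable_manifold g x0 = {x. \<exists>u::nat \<Rightarrow> 'a. u 0 = x \<and> (\<forall>i. g (u (Suc i)) = u i) \<and> u \<longlonglongrightarrow> x0}"

definition complex_matrix :: "real ^ 'n ^ 'n \<Rightarrow> complex ^ 'n::finite ^ 'n" where
  "complex_matrix A = (\<chi> i j. complex_of_real (A $ i $ j))"

definition complex_eigenvalues :: "real ^ 'n::finite ^ 'n \<Rightarrow> complex set" where
  "complex_eigenvalues A = {\<mu>. \<exists>v. v \<noteq> 0 \<and> complex_matrix A *v v = \<mu> *s v}"

text \<open>The characteristic polynomial \<open>det (t I - A)\<close>, as a determinant over polynomials in \<open>t\<close>.\<close>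

definition characteristic_poly :: "'a::comm_ring_1 ^ 'n ^ 'n::finite \<Rightarrow> 'a poly" where
  "characteristic_poly A = det (mat [:0, 1:] - (\<chi> i j. [:A $ i $ j:]))"

definition algebraic_multiplicity :: "real ^ 'n::finite ^ 'n \<Rightarrow> complex \<Rightarrow> nat" where
  "algebraic_multiplicity A \<mu> = order \<mu> (characteristic_poly (complex_matrix A))"

text \<open>The maximum modulus of a finite set of complex numbers, with the convention 0 for \<open>{}\<close>.\<close>

definition max_modulus :: "complex set \<Rightarrow> real" where
  "max_modulus S = (if S = {} then 0 else Max (cmod ` S))"

definition right_eigenvector :: "real ^ 'n::finite ^ 'n \<Rightarrow> real \<Rightarrow> real ^ 'n \<Rightarrow> bool" where
  "right_eigenvector A \<mu> v \<longleftrightarrow> v \<noteq> 0 \<and> A *v v = \<mu> *s v"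

definition left_eigenvector :: "real ^ 'n::finite ^ 'n \<Rightarrow> real \<Rightarrow> real ^ 'n \<Rightarrow> bool" where
  "left_eigenvector A \<mu> w \<longleftrightarrow> w \<noteq> 0 \<and> w v* A = \<mu> *s w"

end

theory Submission
  imports Defs "HOL-Computational_Algebra.Fundamental_Theorem_Algebra"
begin

text \<open>
  Centre coordinates at the fixed point \<open>x 0\<close> of \<open>f\<^sub>X\<close> and write \<open>M\<close> for the linear part of
  \<open>f\<^sub>X\<close> and \<open>f\<^sub>Y (x 0 + d) = x 0 + g + Q d\<close>. (Inside the locales the eigenvalues are \<open>lam1\<close>, \<open>lam2\<close>, the left
  eigenvectors \<open>w1\<close>, \<open>w2\<close> and the right ones \<open>z1\<close>, \<open>z2\<close>.)

  The sequence \<open>X\<^sup>\<infinity> Y X\<^sup>\<infinity>\<close> shifted by \<open>n = length X\<close> differs from the unshifted one at two indices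
  only, and there the shifted orbit lies on the switching manifold, where both pieces of the map agree.
  So \<open>i \<mapsto> y (i + n)\<close> is a second admissible orbit with the same symbols as \<open>y\<close>. The two orbits pass
  through \<open>x 0 + a \<zeta>1\<close> and \<open>x 0 + \<lambda>1 a \<zeta>1\<close> at time 0 and both land in the stable hyperplane at time
  \<open>length Y\<close>. As \<open>f\<^sub>Y\<close> is affine it maps the whole unstable line into the stable hyperplane:
  \<open>\<omega>1 \<bullet> Q \<zeta>1 = 0\<close> and \<open>\<omega>1 \<bullet> g = 0\<close>. Hence \<open>c = - b e\<close> with \<open>b = \<omega>1 \<bullet> Q \<zeta>2\<close> and
  \<open>e = \<omega>2 \<bullet> Q \<zeta>1\<close>. Comparing the \<open>\<zeta>2\<close>-components of the two orbits gives
  \<open>\<omega>2 \<bullet> g = - (1 + \<lambda>1) a e\<close> (\<open>global_map_relations\<close>).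

  An \<open>X\<^sup>k Y\<close>-cycle corresponds to a solution of \<open>d = M\<^sup>k (g + Q d)\<close>, where \<open>d\<close> is its position just
  before \<open>Y\<close>. Because \<open>\<lambda>1 \<lambda>2 = 1\<close>, a vector with \<open>\<zeta>1\<close>-component \<open>u\<close> and \<open>\<zeta>2\<close>-component
  \<open>\<lambda>2\<^sup>k V\<close> is mapped to one of the same form, and as \<open>k \<rightarrow> \<infinity>\<close> the map on \<open>(u, V)\<close> tends to
  \<open>(u, V) \<mapsto> (b V, \<omega>2 \<bullet> g + e u)\<close>. The eigenvalues of its linear part are the square roots of
  \<open>b e = - c\<close>, so \<open>c < 1\<close> makes the return map a contraction in a norm that weighs the \<open>\<zeta>2\<close>-component
  with \<open>\<lambda>2\<^sup>-\<^sup>k\<close> and the remaining components with \<open>\<kappa>\<^sup>-\<^sup>k\<close> for some \<open>\<kappa>\<close> between \<open>\<beta>\<close> and \<open>\<lambda>2\<close>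
  (\<open>return_map_contraction\<close>). The contraction yields the fixed point, the stability of the cycle, and
  the convergence of \<open>d\<close> to \<open>u \<zeta>1\<close> with \<open>u = c (1 + \<lambda>1) a / (1 + c)\<close>
  (\<open>return_map_fixed_points\<close>).

  The condition \<open>\<lambda>2 < c < 1\<close> puts \<open>u\<close> strictly between \<open>a\<close> and \<open>\<lambda>1 a\<close>. So the orbit with the same
  symbols through \<open>x 0 + u \<zeta>1\<close> is a proper convex combination of the two admissible orbits above. It
  meets the switching manifold only where both of them do at the same time, which never happens: at
  nonnegative times by hypothesis, and at negative times because both lie on a line through a point of
  the \<open>X\<close>-cycle (\<open>not_both_on_sigma\<close>). Finally, the points of the \<open>X\<^sup>k Y\<close>-cycle are, for large \<open>k\<close>,
  close either to points of this limit orbit or to the \<open>X\<close>-cycle (\<open>return_orbit_in_open_set\<close>), so the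
  cycle has the required symbols strictly, off the switching manifold.

  The spectral input is that \<open>M\<^sup>k\<close> decays like \<open>\<gamma>\<^sup>k\<close> for some \<open>\<gamma> < \<lambda>2\<close> on the complement of
  \<open>\<zeta>1\<close> and \<open>\<zeta>2\<close> (\<open>complement_decay\<close>). It follows from the fundamental theorem of algebra applied to
  a polynomial that annihilates a given vector.
\<close>

section \<open>Polynomials acting on a vector and geometric decay\<close>

text \<open>
  The vector \<open>p(A) v\<close>, in Horner form so that it obeys the recursion of \<open>pCons\<close>.
\<close>
definition poly_act :: "complex ^ 'n::finite ^ 'n \<Rightarrow> complex poly \<Rightarrow> complex ^ 'n \<Rightarrow> complex ^ 'n" where
  "poly_act A p v = fold_coeffs (\<lambda>a w. a *s v + A *v w) p 0"

lemma poly_act_0 [simp]: "poly_act A 0 v = 0"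
  by (simp add: poly_act_def)

lemma poly_act_pCons [simp]: "poly_act A (pCons a p) v = a *s v + A *v poly_act A p v"
  by (cases "a = 0 \<and> p = 0")
    (auto simp: poly_act_def fold_coeffs_pCons_coeff_not_0_eq fold_coeffs_pCons_not_0_0_eq)

lemma poly_act_add: "poly_act A (p + q) v = poly_act A p v + poly_act A q v"
  by (induction p q rule: poly_induct2)
    (auto simp: vec.scale_left_distrib matrix_vector_right_distrib algebra_simps)

lemma poly_act_smult: "poly_act A (smult c p) v = c *s poly_act A p v"
  by (induction p) (auto simp: vec.scale_right_distrib vector_scalar_commute)

lemma poly_act_minus: "poly_act A (- p) v = - poly_act A p v"
  using poly_act_smult[of A "- 1" p v] by (simp add: vector_sneg_minus1[symmetric])

lemma poly_act_sum: "poly_act A (\<Sum>i\<in>I. p i) v = (\<Sum>i\<in>I. poly_act A (p i) v)"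
  by (induction I rule: infinite_finite_induct) (auto simp: poly_act_add)

lemma poly_act_monom: "poly_act A (monom c i) v = c *s ((*v) A ^^ i) v"
  by (induction i) (auto simp: monom_0 monom_Suc vector_scalar_commute)

lemma poly_act_linear_factor:
  "poly_act A ([:- \<mu>, 1:] * q) v = A *v poly_act A q v - \<mu> *s poly_act A q v"
proof -
  have "[:- \<mu>, 1:] * q = smult (- \<mu>) q + pCons 0 q"
    by simp
  then show ?thesis
    by (simp only: poly_act_add poly_act_smult poly_act_pCons) (simp add: vec.scale_minus_left)
qed

lemma poly_act_commute_linear_factor:
  "poly_act A q (A *v v - \<mu> *s v) = A *v poly_act A q v - \<mu> *s poly_act A q v"
proof (induction q)
  case (pCons a q)
  show ?case
    unfolding poly_act_pCons pCons.IH
    by (simp add: vec.scale_right_distrib vec.scale_right_diff_distrib matrix_vector_right_distrib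
      matrix_vector_mult_diff_distrib vector_scalar_commute mult.commute)
qed simp

text \<open>
  The iterates \<open>A\<^sup>i v\<close> with \<open>i\<close> up to the real dimension are too many to be independent over the reals.
  A repeated iterate is treated separately because dependence is a property of the set of iterates.
\<close>
lemma annihilating_poly_exists:
  fixes A :: "complex ^ 'n::finite ^ 'n"
  obtains p where "p \<noteq> 0" "poly_act A p v = 0"
proof -
  let ?f = "\<lambda>i. ((*v) A ^^ i) v"
  let ?D = "DIM(complex ^ 'n)"
  show ?thesis
  proof (cases "inj_on ?f {..?D}")
    case True
    have "card (?f ` {..?D}) = Suc ?D"
      using True by (simp add: card_image)
    then have "dependent (?f ` {..?D})"
      using independent_bound[of "?f ` {..?D}"] by fastforce
    then obtain u where u: "\<exists>v\<in>?f ` {..?D}. u v \<noteq> 0"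
      and "(\<Sum>v\<in>?f ` {..?D}. u v *\<^sub>R v) = 0"
      using dependent_finite[of "?f ` {..?D}"] by auto
    then have s: "(\<Sum>i\<le>?D. u (?f i) *\<^sub>R ?f i) = 0"
      using sum.reindex[OF True, of "\<lambda>v. u v *\<^sub>R v"] by (simp add: o_def)
    let ?p = "\<Sum>i\<le>?D. monom (complex_of_real (u (?f i))) i"
    obtain j where j: "j \<le> ?D" "u (?f j) \<noteq> 0"
      using u by auto
    have "coeff ?p j = complex_of_real (u (?f j))"
      using j by (simp add: coeff_sum coeff_monom sum.delta)
    then have "?p \<noteq> 0"
      using j by force
    moreover have "poly_act A ?p v = 0"
    proof -
      have r: "complex_of_real r *s w = r *\<^sub>R w" for r and w :: "complex ^ 'n"
        by (simp add: vec_eq_iff, simp add: scaleR_conv_of_real)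
      show ?thesis
        unfolding poly_act_sum poly_act_monom r by (rule s)
    qed
    ultimately show ?thesis
      using that by blast
  next
    case False
    then obtain i j where ij: "i \<noteq> j" "?f i = ?f j"
      by (auto simp: inj_on_def)
    let ?p = "monom 1 i + - monom (1::complex) j"
    have "coeff ?p i \<noteq> coeff 0 i"
      using ij by (simp add: coeff_monom)
    then have "?p \<noteq> 0"
      by (rule contrapos_nn) (simp only:)
    moreover have "poly_act A ?p v = 0"
      using ij by (simp add: poly_act_add poly_act_minus poly_act_monom del: add_uminus_conv_diff)
    ultimately show ?thesis
      using that by blast
  qed
qed

lemma norm_vector_scalar_mult: "norm (c *s (v :: complex ^ 'n::finite)) = cmod c * norm v"
  by (simp add: norm_vec_def norm_mult L2_set_right_distrib)

text \<open>
  Induction on the degree of a polynomial annihilating the vector. A root \<open>\<mu>\<close> is split off. Either the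
  corresponding factor can be dropped, or what remains is an eigenvector for \<open>\<mu>\<close>, so that \<open>\<mu>\<close> is small.
  In the latter case the bound for \<open>A u - \<mu> u\<close> passes to \<open>u\<close> with the same rate, because \<open>\<bar>\<mu>\<bar> < \<gamma>\<close>
  strictly.
\<close>
lemma geometric_bound_from_eigenvalues:
  fixes A :: "complex ^ 'n::finite ^ 'n"
  assumes closed: "0 \<in> S" "\<And>u w. u \<in> S \<Longrightarrow> w \<in> S \<Longrightarrow> u + w \<in> S" "\<And>c u. u \<in> S \<Longrightarrow> c *s u \<in> S"
      "\<And>u. u \<in> S \<Longrightarrow> A *v u \<in> S"
    and ev: "\<And>\<mu> u. u \<in> S \<Longrightarrow> u \<noteq> 0 \<Longrightarrow> A *v u = \<mu> *s u \<Longrightarrow> cmod \<mu> < \<gamma>"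
    and \<gamma>: "0 < \<gamma>" and v: "v \<in> S"
  obtains C where "\<And>k. norm (((*v) A ^^ k) v) \<le> C * \<gamma> ^ k"
proof -
  have act_S: "poly_act A q u \<in> S" if "u \<in> S" for q u
    using that by (induction q) (auto intro: closed)
  have diff_S: "A *v u - \<mu> *s u \<in> S" if "u \<in> S" for u \<mu>
    using closed(2)[OF closed(4)[OF that] closed(3)[OF that, of "- \<mu>"]]
    by (simp add: vec.scale_minus_left)
  have main: "\<exists>C. \<forall>k. norm (((*v) A ^^ k) u) \<le> C * \<gamma> ^ k"
    if "p \<noteq> 0" "poly_act A p u = 0" "u \<in> S" "degree p = m" for p u m
    using that
  proof (induction m arbitrary: p u)
    case 0
    then obtain a where "p = [:a:]" "a \<noteq> 0"
      by (metis degree_eq_zeroE pCons_0_0)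
    then have "u = 0"
      using 0 by simp
    then have "((*v) A ^^ k) u = 0" for k
      by (induction k) auto
    then show ?case
      by (intro exI[of _ 0]) simp
  next
    case (Suc m)
    have "\<not> constant (poly p)"
      using Suc.prems by (simp add: constant_degree)
    then obtain \<mu> where "poly p \<mu> = 0"
      using fundamental_theorem_of_algebra by blast
    then obtain q where q: "p = [:- \<mu>, 1:] * q"
      by (metis poly_eq_0_iff_dvd dvdE)
    then have q0: "q \<noteq> 0"
      using Suc.prems by force
    have dq: "degree q = m"
      using Suc.prems(4) q0 unfolding q by (subst (asm) degree_mult_eq) auto
    let ?w = "poly_act A q u"
    have w: "A *v ?w = \<mu> *s ?w"
      using Suc.prems(2) unfolding q poly_act_linear_factor by simp
    show ?case
    proof (cases "?w = 0")
      case True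
      then show ?thesis
        using Suc.IH[OF q0 True Suc.prems(3) dq] by blast
    next
      case False
      then have \<mu>: "cmod \<mu> < \<gamma>"
        using ev[OF act_S[OF Suc.prems(3)] False w] by blast
      let ?u = "A *v u - \<mu> *s u"
      have "poly_act A q ?u = 0"
        using w by (simp add: poly_act_commute_linear_factor)
      from Suc.IH[OF q0 this diff_S[OF Suc.prems(3)] dq]
      obtain C where C: "\<And>k. norm (((*v) A ^^ k) ?u) \<le> C * \<gamma> ^ k"
        by blast
      \<comment> \<open>Chosen such that \<open>\<bar>\<mu>\<bar> C' + C \<le> \<gamma> C'\<close>, which is what the induction step needs.\<close>
      define C' where "C' = max (norm u) (C / (\<gamma> - cmod \<mu>))"
      have "C / (\<gamma> - cmod \<mu>) \<le> C'"
        by (simp add: C'_def)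
      then have C': "C \<le> C' * (\<gamma> - cmod \<mu>)"
        using \<mu> by (simp add: pos_divide_le_eq)
      have rec: "((*v) A ^^ Suc k) u = \<mu> *s ((*v) A ^^ k) u + ((*v) A ^^ k) ?u" for k
      proof (induction k)
        case (Suc k)
        have "((*v) A ^^ Suc (Suc k)) u = A *v (((*v) A ^^ Suc k) u)"
          by simp
        also have "\<dots> = A *v (\<mu> *s ((*v) A ^^ k) u + ((*v) A ^^ k) ?u)"
          by (simp only: Suc)
        also have "\<dots> = \<mu> *s ((*v) A ^^ Suc k) u + ((*v) A ^^ Suc k) ?u"
          by (simp add: matrix_vector_right_distrib vector_scalar_commute)
        finally show ?case .
      qed simp
      have "norm (((*v) A ^^ k) u) \<le> C' * \<gamma> ^ k" for k
      proof (induction k)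
        case 0
        show ?case by (simp add: C'_def)
      next
        case (Suc k)
        have "norm (((*v) A ^^ Suc k) u) \<le> cmod \<mu> * norm (((*v) A ^^ k) u) + norm (((*v) A ^^ k) ?u)"
          unfolding rec by (metis norm_triangle_ineq norm_vector_scalar_mult)
        also have "\<dots> \<le> cmod \<mu> * (C' * \<gamma> ^ k) + C * \<gamma> ^ k"
          by (intro add_mono mult_left_mono Suc C) auto
        also have "\<dots> \<le> cmod \<mu> * (C' * \<gamma> ^ k) + C' * (\<gamma> - cmod \<mu>) * \<gamma> ^ k"
          using \<gamma> by (intro add_left_mono mult_right_mono C') auto
        also have "\<dots> = C' * \<gamma> ^ Suc k"
          by (simp add: algebra_simps)
        finally show ?case .
      qed
      then show ?thesis by blast
    qed
  qed
  obtain p where "p \<noteq> 0" "poly_act A p v = 0"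
    by (rule annihilating_poly_exists)
  from main[OF this v refl] show ?thesis
    using that by blast
qed

section \<open>Simple roots of the characteristic polynomial\<close>

lemma poly_det: "poly (det A) t = det (\<chi> i j. poly (A $ i $ j) t)"
  for A :: "'a::comm_ring_1 poly ^ 'n::finite ^ 'n"
  by (simp add: det_def poly_sum poly_prod)

lemma poly_characteristic_poly: "poly (characteristic_poly A) t = det (mat t - A)"
  unfolding characteristic_poly_def poly_det
  by (intro arg_cong[of _ _ det]) (simp add: vec_eq_iff mat_def)

lemma mat_minus_vector_mult: "(mat t - A) *v v = t *s v - A *v v" for A :: "'a::comm_ring_1 ^ 'n::finite ^ 'n"
  by (simp add: vec_eq_iff matrix_vector_mult_def mat_def algebra_simps sum_subtractf
    if_distrib[of "\<lambda>x. x * _"] if_distrib[of "\<lambda>x. _ * x"] cong: if_cong)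

lemma det_eq_0_iff_kernel: "det B = 0 \<longleftrightarrow> (\<exists>v. v \<noteq> 0 \<and> B *v v = 0)" for B :: "'a::field ^ 'n::finite ^ 'n"
  using invertible_det_nz[of B] invertible_left_inverse[of B] matrix_left_invertible_ker[of B]
  by blast

lemma complex_eigenvalue_iff_root:
  "\<mu> \<in> complex_eigenvalues A \<longleftrightarrow> poly (characteristic_poly (complex_matrix A)) \<mu> = 0"
  unfolding complex_eigenvalues_def poly_characteristic_poly det_eq_0_iff_kernel mat_minus_vector_mult
  by auto

text \<open>
  Outside the ball whose radius is the operator norm there are no eigenvalues, so the polynomial has a
  non-root. The \<open>order\<close> of a root is meaningful only for a nonzero polynomial.
\<close>
lemma characteristic_poly_nonzero: "characteristic_poly A \<noteq> 0" for A :: "complex ^ 'n::finite ^ 'n"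
proof -
  have "linear ((*v) A)"
    by (rule linearI)
      (simp_all add: matrix_vector_mult_def vec_eq_iff scaleR_sum_right sum.distrib algebra_simps)
  then obtain K where K: "\<And>v. norm (A *v v) \<le> K * norm v"
    using linear_bounded by blast
  let ?t = "complex_of_real (\<bar>K\<bar> + 1)"
  have "det (mat ?t - A) \<noteq> 0"
  proof
    assume "det (mat ?t - A) = 0"
    then obtain v where v: "v \<noteq> 0" "A *v v = ?t *s v"
      unfolding det_eq_0_iff_kernel mat_minus_vector_mult by auto
    have "(\<bar>K\<bar> + 1) * norm v \<le> K * norm v"
      using K[of v] unfolding v(2) norm_vector_scalar_mult by (simp del: of_real_add)
    then show False
      using v(1) by (simp add: mult_le_cancel_right)
  qed
  then show ?thesis
    by (metis poly_characteristic_poly poly_0)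
qed

lemma finite_complex_eigenvalues: "finite (complex_eigenvalues A)"
proof -
  have "complex_eigenvalues A = {\<mu>. poly (characteristic_poly (complex_matrix A)) \<mu> = 0}"
    using complex_eigenvalue_iff_root by blast
  then show ?thesis
    using poly_roots_finite[OF characteristic_poly_nonzero] by simp
qed

lemma det_columns_mul:
  assumes "\<And>i j. M $ i $ j = c j * N $ i $ j"
  shows "det M = prod c UNIV * det (N :: 'a::comm_ring_1 ^ 'n::finite ^ 'n)"
proof -
  have "transpose M = (\<chi> i. c i *s (transpose N) $ i)"
    using assms by (simp add: vec_eq_iff transpose_def)
  then have "det (transpose M) = prod c UNIV * det (\<chi> i. transpose N $ i)"
    using det_rows_mul[of c "\<lambda>i. transpose N $ i"] by simp
  then show ?thesis
    by simp
qed

text \<open>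
  Two columns of the identity matrix are replaced by the eigenvectors \<open>u\<close> and \<open>v\<close>, which gives an
  invertible constant matrix \<open>P\<close>. In \<open>(t I - A) P\<close> these two columns are divisible by \<open>t - l\<close>, so
  \<open>(t - l)\<^sup>2\<close> divides \<open>det (t I - A) * det P\<close>.
\<close>
lemma order_ge_2_if_two_eigenvectors:
  fixes A :: "complex ^ 'n::finite ^ 'n"
  assumes ev: "A *v u = l *s u" "A *v v = l *s v"
    and indep: "u $ i \<noteq> 0" "v $ i = 0" "v \<noteq> 0"
  shows "order l (characteristic_poly A) \<ge> 2"
proof -
  obtain j where j: "v $ j \<noteq> 0"
    using indep(3) by (auto simp: vec_eq_iff)
  then have ij: "i \<noteq> j"
    using indep by auto
  define P :: "complex ^ 'n ^ 'n" where
    "P = (\<chi> r s. if s = i then u $ r else if s = j then v $ r else if r = s then 1 else 0)"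
  have Pv: "P *v w = w $ i *s u + w $ j *s v + (\<chi> r. if r = i \<or> r = j then 0 else w $ r)" for w
  proof -
    have "(\<Sum>s\<in>UNIV. P $ r $ s * w $ s) =
      (\<Sum>s\<in>UNIV. (if s = i then u $ r * w $ i else 0) + (if s = j then v $ r * w $ j else 0)
        + (if s = r then (if r = i \<or> r = j then 0 else w $ r) else 0))" for r
      using ij by (intro sum.cong) (auto simp: P_def)
    then show ?thesis
      by (simp add: vec_eq_iff matrix_vector_mult_def sum.distrib mult.commute)
  qed
  have "det P \<noteq> 0"
  proof
    assume "det P = 0"
    then obtain w where w: "w \<noteq> 0" "P *v w = 0"
      using det_eq_0_iff_kernel by blast
    then have c: "w $ i * u $ r + w $ j * v $ r + (if r = i \<or> r = j then 0 else w $ r) = 0" for r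
      unfolding Pv by (simp add: vec_eq_iff)
    have "w $ i = 0"
      using c[of i] indep by simp
    moreover have "w $ j = 0"
      using c[of j] j \<open>w $ i = 0\<close> by simp
    ultimately have "w $ r = 0" for r
      using c[of r] by (cases "r = i \<or> r = j") auto
    then show False
      using w(1) by (simp add: vec_eq_iff)
  qed
  let ?q = "[:- l, 1:]"
  let ?B = "mat [:0, 1:] - (\<chi> r s. [:A $ r $ s:]) :: complex poly ^ 'n ^ 'n"
  let ?P = "(\<chi> r s. [:P $ r $ s:]) :: complex poly ^ 'n ^ 'n"
  \<comment> \<open>The product with the factor \<open>t - l\<close> removed from the two columns of eigenvectors.\<close>
  define N :: "complex poly ^ 'n ^ 'n" where
    "N = (\<chi> r s. if s = i then [:u $ r:] else if s = j then [:v $ r:] else (?B ** ?P) $ r $ s)"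
  define c where "c = (\<lambda>s. if s = i \<or> s = j then ?q else 1)"
  have BP: "(?B ** ?P) $ r $ s = [:0, 1:] * [:P $ r $ s:] - [:(A ** P) $ r $ s:]" for r s
  proof -
    have "(\<Sum>k\<in>UNIV. ?B $ r $ k * ?P $ k $ s) =
      (\<Sum>k\<in>UNIV. (if k = r then [:0, 1:] * [:P $ r $ s:] else 0) - [:A $ r $ k * P $ k $ s:])"
      by (intro sum.cong) (auto simp: mat_def algebra_simps)
    also have "\<dots> = [:0, 1:] * [:P $ r $ s:] - (\<Sum>k\<in>UNIV. [:A $ r $ k * P $ k $ s:])"
      by (simp add: sum_subtractf)
    also have "(\<Sum>k\<in>UNIV. [:A $ r $ k * P $ k $ s:]) = [:\<Sum>k\<in>UNIV. A $ r $ k * P $ k $ s:]"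
      by (simp add: poly_eq_iff coeff_sum coeff_pCons sum.neutral split: nat.split)
    finally show ?thesis
      by (simp add: matrix_matrix_mult_def)
  qed
  have col: "(A ** P) $ r $ i = (A *v u) $ r" "(A ** P) $ r $ j = (A *v v) $ r" for r
    using ij by (auto simp: matrix_matrix_mult_def matrix_vector_mult_def P_def)
  have "(?B ** ?P) $ r $ s = c s * N $ r $ s" for r s
  proof -
    consider "s = i" | "s = j" | "s \<noteq> i" "s \<noteq> j" by blast
    then show ?thesis
    proof cases
      case 1
      then show ?thesis
        unfolding BP using col(1)[of r] ev(1) by (simp add: c_def N_def) (simp add: P_def)
    next
      case 2
      then show ?thesis
        unfolding BP using col(2)[of r] ev(2) ij by (simp add: c_def N_def) (simp add: P_def)
    next
      case 3
      then show ?thesis by (simp add: c_def N_def)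
    qed
  qed
  then have "det (?B ** ?P) = prod c UNIV * det N"
    by (rule det_columns_mul)
  moreover have "prod c UNIV = ?q ^ 2"
  proof -
    have "prod c UNIV = prod c {i, j}"
      by (rule prod.mono_neutral_right) (auto simp: c_def)
    then show ?thesis
      using ij by (simp add: c_def power2_eq_square)
  qed
  moreover have "det (?B ** ?P) = characteristic_poly A * det ?P"
    by (simp add: det_mul characteristic_poly_def)
  moreover have "det ?P = [:det P:]"
    by (rule poly_eq_poly_eq_iff[THEN iffD1]) (simp add: fun_eq_iff poly_det)
  ultimately have "smult (det P) (characteristic_poly A) = ?q ^ 2 * det N"
    by (simp add: mult.commute)
  then have "?q ^ 2 dvd characteristic_poly A"
    using \<open>det P \<noteq> 0\<close> by (metis dvd_smult_cancel dvd_triv_left)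
  then show ?thesis
    using characteristic_poly_nonzero[of A] by (simp add: order_divides)
qed

section \<open>Decay on the complement of two simple eigenvalues\<close>

lemma left_right_eigenvectors_orthogonal:
  assumes "left_eigenvector A \<mu> w" "right_eigenvector A \<nu> z" "\<mu> \<noteq> \<nu>"
  shows "w \<bullet> z = 0"
proof -
  have "\<mu> * (w \<bullet> z) = w \<bullet> (A *v z)"
    using assms(1) by (simp add: left_eigenvector_def dot_lmul_matrix[symmetric] scalar_mult_eq_scaleR)
  also have "\<dots> = \<nu> * (w \<bullet> z)"
    using assms(2) by (simp add: right_eigenvector_def scalar_mult_eq_scaleR)
  finally show ?thesis
    using assms(3) by simp
qed

definition complex_vec :: "real ^ 'n::finite \<Rightarrow> complex ^ 'n" where
  "complex_vec d = (\<chi> i. complex_of_real (d $ i))"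

lemma norm_complex_vec: "norm (complex_vec d) = norm d"
  by (simp add: complex_vec_def norm_vec_def)

lemma complex_matrix_complex_vec: "complex_matrix A *v complex_vec d = complex_vec (A *v d)"
  by (simp add: complex_vec_def complex_matrix_def matrix_vector_mult_def vec_eq_iff)

lemma complex_matrix_complex_vec_power:
  "((*v) (complex_matrix A) ^^ k) (complex_vec d) = complex_vec (((*v) A ^^ k) d)"
  by (induction k) (simp_all add: complex_matrix_complex_vec)

text \<open>
  The bilinear extension of \<open>w \<bullet> v\<close> to complex vectors, without conjugation: it has to be complex linear.
\<close>
definition complex_functional :: "real ^ 'n::finite \<Rightarrow> complex ^ 'n \<Rightarrow> complex" where
  "complex_functional w v = (\<Sum>i\<in>UNIV. complex_of_real (w $ i) * v $ i)"

lemma complex_functional_complex_vec: "complex_functional w (complex_vec d) = complex_of_real (w \<bullet> d)"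
  by (simp add: complex_functional_def complex_vec_def inner_vec_def)

lemma complex_functional_linear [simp]:
  "complex_functional w 0 = 0"
  "complex_functional w (u + v) = complex_functional w u + complex_functional w v"
  "complex_functional w (u - v) = complex_functional w u - complex_functional w v"
  "complex_functional w (c *s u) = c * complex_functional w u"
  by (simp_all add: complex_functional_def algebra_simps sum.distrib sum_subtractf sum_distrib_left)

lemma complex_functional_left_eigenvector:
  assumes "left_eigenvector A \<mu> w"
  shows "complex_functional w (complex_matrix A *v v) = \<mu> * complex_functional w v"
proof -
  have col: "(\<Sum>i\<in>UNIV. w $ i * A $ i $ j) = \<mu> * w $ j" for j
    using assms by (simp add: left_eigenvector_def vector_matrix_mult_def vec_eq_iff mult.commute)
  have "complex_functional w (complex_matrix A *v v) =
      (\<Sum>j\<in>UNIV. \<Sum>i\<in>UNIV. complex_of_real (w $ i * A $ i $ j) * v $ j)"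
    unfolding complex_functional_def matrix_vector_mult_def complex_matrix_def
    by (subst sum.swap) (simp add: sum_distrib_left mult.assoc)
  also have "\<dots> = (\<Sum>j\<in>UNIV. complex_of_real (\<Sum>i\<in>UNIV. w $ i * A $ i $ j) * v $ j)"
    by (simp add: sum_distrib_right)
  also have "\<dots> = \<mu> * complex_functional w v"
    unfolding col by (simp add: complex_functional_def sum_distrib_left mult.assoc)
  finally show ?thesis .
qed

text \<open>
  An eigenvector in the kernel of \<open>w\<close> is not a multiple of \<open>z\<close>, as \<open>w \<bullet> z = 1\<close>, so it would be a second
  independent eigenvector.
\<close>
lemma simple_eigenvalue_eigenvector_not_in_kernel:
  assumes mult: "algebraic_multiplicity A (complex_of_real \<mu>) = 1"
    and z: "right_eigenvector A \<mu> z" and wz: "w \<bullet> z = 1"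
    and u: "complex_matrix A *v u = complex_of_real \<mu> *s u" "complex_functional w u = 0"
  shows "u = 0"
proof (rule ccontr)
  assume "u \<noteq> 0"
  obtain i where i: "z $ i \<noteq> 0"
    using z by (auto simp: right_eigenvector_def vec_eq_iff)
  let ?z = "complex_vec z"
  define t where "t = u $ i / ?z $ i"
  \<comment> \<open>Subtracting a multiple of \<open>z\<close> makes the \<open>i\<close>-th component vanish.\<close>
  define v where "v = u - t *s ?z"
  have zi: "?z $ i \<noteq> 0"
    using i by (simp add: complex_vec_def)
  have evz: "complex_matrix A *v ?z = complex_of_real \<mu> *s ?z"
    using z by (simp add: complex_matrix_complex_vec right_eigenvector_def)
      (simp add: complex_vec_def vec_eq_iff)
  have "v \<noteq> 0"
  proof
    assume v: "v = 0"
    then have "complex_functional w v = 0"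
      by simp
    then have "t = 0"
      by (simp add: v_def u complex_functional_complex_vec wz)
    then show False
      using v \<open>u \<noteq> 0\<close> by (simp add: v_def)
  qed
  moreover have "v $ i = 0"
    using zi by (simp add: v_def t_def)
  moreover have "complex_matrix A *v v = complex_of_real \<mu> *s v"
    by (simp add: v_def matrix_vector_mult_diff_distrib vector_scalar_commute u evz
        vec.scale_right_diff_distrib mult.commute)
  ultimately have "order (complex_of_real \<mu>) (characteristic_poly (complex_matrix A)) \<ge> 2"
    using order_ge_2_if_two_eigenvectors[OF evz _ zi] by blast
  then show False
    using mult by (simp add: algebraic_multiplicity_def)
qed

lemma matrix_iterate_linear: "linear ((*v) A ^^ k)" for A :: "real ^ 'n::finite ^ 'n"
proof (induction k)
  case (Suc k)
  have "linear ((*v) A \<circ> ((*v) A ^^ k))"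
    using Suc by (intro linear_compose) simp_all
  then show ?case
    by (simp add: o_def)
qed (simp add: linear_id id_def[symmetric])

text \<open>
  The common kernel of \<open>w1\<close> and \<open>w2\<close> is invariant, and by simplicity it contains no eigenvector for
  \<open>lam1\<close> or \<open>lam2\<close>. All eigenvalues seen there have modulus at most \<open>\<beta>\<close>. Any rate strictly above \<open>\<beta>\<close>
  is allowed, which absorbs the polynomial factors of Jordan blocks.
\<close>
lemma complement_decay:
  fixes M :: "real ^ 'n::finite ^ 'n"
  assumes mult: "algebraic_multiplicity M (complex_of_real lam1) = 1"
      "algebraic_multiplicity M (complex_of_real lam2) = 1"
    and \<beta>: "\<beta> = max_modulus (complex_eigenvalues M - {complex_of_real lam1, complex_of_real lam2})"
      "0 \<le> \<beta>" "\<beta> < lam2"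
    and left: "left_eigenvector M lam1 w1" "left_eigenvector M lam2 w2"
    and right: "right_eigenvector M lam1 z1" "right_eigenvector M lam2 z2"
    and norm1: "w1 \<bullet> z1 = 1" "w2 \<bullet> z2 = 1" and orth: "w1 \<bullet> z2 = 0" "w2 \<bullet> z1 = 0"
  obtains C \<gamma> where "0 < \<gamma>" "\<gamma> < lam2" "0 \<le> C"
    "\<And>k d. w1 \<bullet> d = 0 \<Longrightarrow> w2 \<bullet> d = 0 \<Longrightarrow> norm (((*v) M ^^ k) d) \<le> C * \<gamma> ^ k * norm d"
proof -
  define \<gamma> where "\<gamma> = (\<beta> + lam2) / 2"
  have \<gamma>: "0 < \<gamma>" "\<gamma> < lam2" "\<beta> < \<gamma>"
    using \<beta> by (auto simp: \<gamma>_def)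
  define S where "S = {v. complex_functional w1 v = 0 \<and> complex_functional w2 v = 0}"
  have ev: "cmod \<mu> < \<gamma>" if u: "u \<in> S" "u \<noteq> 0" "complex_matrix M *v u = \<mu> *s u" for \<mu> u
  proof -
    have "complex_functional w1 u = 0" "complex_functional w2 u = 0"
      using u by (simp_all add: S_def)
    then have "\<mu> \<noteq> complex_of_real lam1" "\<mu> \<noteq> complex_of_real lam2"
      using simple_eigenvalue_eigenvector_not_in_kernel[OF mult(1) right(1) norm1(1), of u]
        simple_eigenvalue_eigenvector_not_in_kernel[OF mult(2) right(2) norm1(2), of u] u(2,3)
      by metis+
    then have mem: "\<mu> \<in> complex_eigenvalues M - {complex_of_real lam1, complex_of_real lam2}"
      using u by (auto simp: complex_eigenvalues_def)
    then have "cmod \<mu> \<le> \<beta>"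
      unfolding \<beta>(1) max_modulus_def using finite_complex_eigenvalues[of M] by (auto intro!: Max_ge)
    then show ?thesis
      using \<gamma> by simp
  qed
  have pointwise: "\<exists>C. \<forall>k. norm (((*v) M ^^ k) d) \<le> C * \<gamma> ^ k"
    if d: "w1 \<bullet> d = 0" "w2 \<bullet> d = 0" for d
  proof -
    have "complex_vec d \<in> S"
      using d by (simp add: S_def complex_functional_complex_vec)
    then obtain C where "\<And>k. norm (((*v) (complex_matrix M) ^^ k) (complex_vec d)) \<le> C * \<gamma> ^ k"
      using geometric_bound_from_eigenvalues[of S "complex_matrix M" \<gamma> "complex_vec d"] ev \<gamma>(1)
        complex_functional_left_eigenvector[OF left(1)] complex_functional_left_eigenvector[OF left(2)]
      unfolding S_def by (auto simp: S_def)
    then show ?thesis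
      by (auto simp: complex_matrix_complex_vec_power norm_complex_vec)
  qed
  define P where "P = (\<lambda>d. d - (w1 \<bullet> d) *\<^sub>R z1 - (w2 \<bullet> d) *\<^sub>R z2)"
  have linP: "linear P"
    by (rule linearI) (simp_all add: P_def algebra_simps)
  have "w1 \<bullet> P d = 0" "w2 \<bullet> P d = 0" for d
    using norm1 orth by (simp_all add: P_def inner_diff_right)
  \<comment> \<open>The bounds hold vector by vector. The projections of the finitely many coordinate vectors make them uniform.\<close>
  then have "\<exists>C. \<forall>k. norm (((*v) M ^^ k) (P (axis i 1))) \<le> C * \<gamma> ^ k" for i
    by (rule pointwise)
  then obtain c where c: "\<And>i k. norm (((*v) M ^^ k) (P (axis i 1))) \<le> c i * \<gamma> ^ k"
    by metis
  have c0: "0 \<le> c i" for i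
    using order_trans[OF norm_ge_zero c[of 0 i]] by simp
  have "norm (((*v) M ^^ k) d) \<le> sum c UNIV * \<gamma> ^ k * norm d" if d: "w1 \<bullet> d = 0" "w2 \<bullet> d = 0" for k d
  proof -
    have "d = P d"
      using d by (simp add: P_def)
    also have "\<dots> = P (\<Sum>i\<in>UNIV. d $ i *\<^sub>R axis i 1)"
      using basis_expansion[of d] by (simp add: scalar_mult_eq_scaleR)
    finally have "((*v) M ^^ k) d = ((*v) M ^^ k) (P (\<Sum>i\<in>UNIV. d $ i *\<^sub>R axis i 1))"
      by simp
    also have "\<dots> = (\<Sum>i\<in>UNIV. d $ i *\<^sub>R ((*v) M ^^ k) (P (axis i 1)))"
      by (simp add: linear_sum[OF linP] linear_sum[OF matrix_iterate_linear] linear_cmul[OF linP]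
          linear_cmul[OF matrix_iterate_linear])
    also have "norm \<dots> \<le> (\<Sum>i\<in>UNIV. norm (d $ i *\<^sub>R ((*v) M ^^ k) (P (axis i 1))))"
      by (rule norm_sum)
    also have "\<dots> \<le> (\<Sum>i\<in>UNIV. norm d * (c i * \<gamma> ^ k))"
      using c c0 component_le_norm_cart[of d] by (intro sum_mono) (auto intro!: mult_mono)
    also have "\<dots> = sum c UNIV * \<gamma> ^ k * norm d"
      by (simp add: sum_distrib_left sum_distrib_right mult_ac)
    finally show ?thesis .
  qed
  moreover have "0 \<le> sum c UNIV"
    using c0 by (simp add: sum_nonneg)
  ultimately show ?thesis
    using that \<gamma> by blast
qed

section \<open>Saddle matrices\<close>

text \<open>
  The spectral facts about \<open>M\<close> that the dynamics use, with the decay on the complement of the two leading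
  directions as an assumption.
\<close>
locale saddle =
  fixes M :: "real ^ 'n::finite ^ 'n"
    and lam1 lam2 C \<gamma> :: real
    and w1 w2 z1 z2 :: "real ^ 'n"
  assumes lam: "0 < lam2" "lam2 < 1" "1 < lam1" "lam1 * lam2 = 1"
    and left: "left_eigenvector M lam1 w1" "left_eigenvector M lam2 w2"
    and right: "right_eigenvector M lam1 z1" "right_eigenvector M lam2 z2"
    and normalised: "w1 \<bullet> z1 = 1" "w2 \<bullet> z2 = 1"
    and gap: "0 < \<gamma>" "\<gamma> < lam2" "0 \<le> C"
    and decay: "\<And>k d. w1 \<bullet> d = 0 \<Longrightarrow> w2 \<bullet> d = 0 \<Longrightarrow> norm (((*v) M ^^ k) d) \<le> C * \<gamma> ^ k * norm d"
begin

abbreviation T :: "nat \<Rightarrow> real ^ 'n \<Rightarrow> real ^ 'n" where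
  "T k \<equiv> (*v) M ^^ k"

definition rest :: "real ^ 'n \<Rightarrow> real ^ 'n" where
  "rest d = d - (w1 \<bullet> d) *\<^sub>R z1 - (w2 \<bullet> d) *\<^sub>R z2"

lemmas T_linear = matrix_iterate_linear[where A = M]

lemma w_M: "w1 \<bullet> (M *v d) = lam1 * (w1 \<bullet> d)" "w2 \<bullet> (M *v d) = lam2 * (w2 \<bullet> d)"
  using left by (simp_all add: left_eigenvector_def dot_lmul_matrix[symmetric] scalar_mult_eq_scaleR)

lemma M_z: "M *v z1 = lam1 *\<^sub>R z1" "M *v z2 = lam2 *\<^sub>R z2"
  using right by (simp_all add: right_eigenvector_def scalar_mult_eq_scaleR)

lemma orthogonal: "w1 \<bullet> z2 = 0" "w2 \<bullet> z1 = 0"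
  using left_right_eigenvectors_orthogonal[OF left(1) right(2)]
    left_right_eigenvectors_orthogonal[OF left(2) right(1)] lam by simp_all

lemma w_T: "w1 \<bullet> T k d = lam1 ^ k * (w1 \<bullet> d)" "w2 \<bullet> T k d = lam2 ^ k * (w2 \<bullet> d)"
  by (induction k) (simp_all add: w_M)

lemma T_z: "T k z1 = lam1 ^ k *\<^sub>R z1" "T k z2 = lam2 ^ k *\<^sub>R z2"
  by (induction k) (simp_all add: M_z matrix_vector_mult_scaleR mult.commute)

lemma rest_kernel: "w1 \<bullet> rest d = 0" "w2 \<bullet> rest d = 0"
  by (simp_all add: rest_def inner_diff_right normalised orthogonal)

lemma split: "d = (w1 \<bullet> d) *\<^sub>R z1 + (w2 \<bullet> d) *\<^sub>R z2 + rest d"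
  by (simp add: rest_def)

lemma rest_linear: "linear rest"
  by (rule linearI) (simp_all add: rest_def algebra_simps)

lemma rest_add: "rest (d + e) = rest d + rest e" and rest_diff: "rest (d - e) = rest d - rest e"
  using rest_linear by (simp_all add: linear_add linear_diff)

lemma rest_z: "rest (r *\<^sub>R z1) = 0" "rest (r *\<^sub>R z2) = 0"
  by (simp_all add: rest_def normalised orthogonal)

lemma T_split: "T k d = (lam1 ^ k * (w1 \<bullet> d)) *\<^sub>R z1 + (lam2 ^ k * (w2 \<bullet> d)) *\<^sub>R z2 + T k (rest d)"
  by (subst split[of d]) (simp only: linear_add[OF T_linear] linear_cmul[OF T_linear] T_z
      scaleR_scaleR mult.commute)

lemma rest_T: "rest (T k d) = T k (rest d)"
  by (subst rest_def) (subst T_split[of k d], simp add: w_T)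

lemma norm_rest_T: "norm (rest (T k d)) \<le> C * \<gamma> ^ k * norm (rest d)"
  unfolding rest_T by (intro decay rest_kernel)

lemma lam_power: "lam1 ^ k * lam2 ^ k = 1"
  by (simp add: power_mult_distrib[symmetric] lam)

text \<open>
  Backward in time the components other than the \<open>z1\<close>-component grow at least geometrically unless they
  vanish. As \<open>M\<close> may be singular, this is argued from \<open>d i = M\<^sup>k (d (i + k))\<close> and not from an inverse.
\<close>
lemma bounded_backward_orbit:
  assumes step: "\<And>i. M *v d (Suc i) = d i" and bdd: "\<And>i. i \<ge> I \<Longrightarrow> norm (d i) \<le> B"
  shows "d i = ((w1 \<bullet> d 0) / lam1 ^ i) *\<^sub>R z1"
proof -
  have unroll: "T k (d (i + k)) = d i" for i k
  proof (induction k arbitrary: i)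
    case (Suc k)
    then show ?case
      using step[of i] Suc[of "Suc i"] by simp
  qed simp
  \<comment> \<open>A fixed quantity bounded by a null sequence vanishes.\<close>
  have small: "r = 0" if "0 \<le> r" "0 < q" "q < 1" and le: "\<And>k. k \<ge> I \<Longrightarrow> r \<le> D * q ^ k" for r q D :: real
  proof -
    have "(\<lambda>k. D * q ^ k) \<longlonglongrightarrow> D * 0"
      using that by (intro tendsto_mult tendsto_const LIMSEQ_power_zero) auto
    then have "r \<le> D * 0"
      by (rule LIMSEQ_le_const) (use le in blast)
    then show ?thesis
      using that by simp
  qed
  have bdd': "norm (d (i + k)) \<le> B" if "k \<ge> I" for k
    using that by (intro bdd) simp
  have w2: "w2 \<bullet> d i = 0"
  proof -
    have "\<bar>w2 \<bullet> d i\<bar> \<le> norm w2 * B * lam2 ^ k" if k: "k \<ge> I" for k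
    proof -
      have "\<bar>w2 \<bullet> d i\<bar> = lam2 ^ k * \<bar>w2 \<bullet> d (i + k)\<bar>"
        using lam w_T(2)[of k "d (i + k)"] by (simp add: unroll abs_mult)
      also have "\<bar>w2 \<bullet> d (i + k)\<bar> \<le> norm w2 * B"
        using Cauchy_Schwarz_ineq2[of w2 "d (i + k)"] mult_left_mono[OF bdd'[OF k], of "norm w2"] by simp
      finally show ?thesis
        using lam by (simp add: mult_left_mono mult.commute)
    qed
    from small[OF _ lam(1,2) this] show ?thesis
      by simp
  qed
  have rest0: "rest (d i) = 0"
  proof -
    obtain K where K: "\<And>v. norm (rest v) \<le> K * norm v" "K > 0"
      using linear_bounded_pos[OF rest_linear] by blast
    have "norm (rest (d i)) \<le> (C * K * B) * \<gamma> ^ k" if k: "k \<ge> I" for k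
    proof -
      have "norm (rest (d i)) \<le> C * \<gamma> ^ k * norm (rest (d (i + k)))"
        using norm_rest_T[of k "d (i + k)"] by (simp add: unroll)
      also have "\<dots> \<le> C * \<gamma> ^ k * (K * B)"
        using gap K(2) by (intro mult_left_mono order_trans[OF K(1)] bdd'[OF k]) auto
      finally show ?thesis
        by (simp add: mult_ac)
    qed
    from small[OF _ gap(1) _ this] show ?thesis
      using gap lam by simp
  qed
  have "w1 \<bullet> d 0 = lam1 ^ i * (w1 \<bullet> d i)"
    using w_T(1)[of i "d i"] unroll[where i=0 and k = i] by simp
  then show ?thesis
    using split[of "d i"] lam by (simp add: w2 rest0)
qed

lemma bounded_forward_orbit:
  assumes bdd: "\<And>k. k \<ge> K \<Longrightarrow> norm (T k d) \<le> B"
  shows "w1 \<bullet> d = 0"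
proof (rule ccontr)
  assume "w1 \<bullet> d \<noteq> 0"
  define r where "r = norm w1 * B / \<bar>w1 \<bullet> d\<bar>"
  obtain k0 where k0: "r < lam1 ^ k0"
    using real_arch_pow[OF lam(3)] by blast
  let ?k = "k0 + K"
  have "\<bar>w1 \<bullet> d\<bar> * lam1 ^ ?k = \<bar>w1 \<bullet> T ?k d\<bar>"
    using lam by (simp add: w_T abs_mult mult.commute)
  also have "\<dots> \<le> norm w1 * B"
    using Cauchy_Schwarz_ineq2[of w1 "T ?k d"] mult_left_mono[OF bdd[of ?k], of "norm w1"] by simp
  finally have "lam1 ^ ?k \<le> r"
    using \<open>w1 \<bullet> d \<noteq> 0\<close> by (simp add: r_def pos_le_divide_eq mult.commute)
  moreover have "lam1 ^ k0 \<le> lam1 ^ ?k"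
    using lam by (intro power_increasing) auto
  ultimately show False
    using k0 by simp
qed

section \<open>The weighted norm and the contraction of the return map\<close>

text \<open>
  The scaling under which the return map converges: \<open>z2\<close>-components are of size \<open>lam2\<^sup>k\<close> and the other
  contracting components of size \<open>\<kappa>\<^sup>k\<close>, both measured against a \<open>z1\<close>-component of size 1.
\<close>
definition weighted_norm :: "real \<Rightarrow> real \<Rightarrow> nat \<Rightarrow> real ^ 'n \<Rightarrow> real" where
  "weighted_norm m \<kappa> k d =
     max \<bar>w1 \<bullet> d\<bar> (max (\<bar>w2 \<bullet> d\<bar> / (m * lam2 ^ k)) (norm (rest d) / \<kappa> ^ k))"

context
  fixes m \<kappa> :: real
  assumes m: "0 < m" and \<kappa>: "0 < \<kappa>" "\<kappa> < lam2"
begin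

abbreviation N :: "nat \<Rightarrow> real ^ 'n \<Rightarrow> real" where
  "N \<equiv> weighted_norm m \<kappa>"

lemma weighted_norm_le_iff:
  "N k d \<le> r \<longleftrightarrow> \<bar>w1 \<bullet> d\<bar> \<le> r \<and> \<bar>w2 \<bullet> d\<bar> \<le> m * lam2 ^ k * r \<and> norm (rest d) \<le> \<kappa> ^ k * r"
  using m \<kappa> lam by (simp add: weighted_norm_def pos_divide_le_eq mult.commute)

lemma weighted_norm_components:
  "\<bar>w1 \<bullet> d\<bar> \<le> N k d" "\<bar>w2 \<bullet> d\<bar> \<le> m * lam2 ^ k * N k d" "norm (rest d) \<le> \<kappa> ^ k * N k d"
  using weighted_norm_le_iff[of k d "N k d"] by simp_all

lemma weighted_norm_nonneg: "0 \<le> N k d"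
  using weighted_norm_components(1)[of d k] by simp

lemma weighted_norm_add: "N k (d + e) \<le> N k d + N k e"
proof -
  have "\<bar>w1 \<bullet> (d + e)\<bar> \<le> N k d + N k e"
    using weighted_norm_components(1)[of d k] weighted_norm_components(1)[of e k] by (simp add: inner_add_right)
  moreover have "\<bar>w2 \<bullet> (d + e)\<bar> \<le> m * lam2 ^ k * (N k d + N k e)"
    using weighted_norm_components(2)[of d k] weighted_norm_components(2)[of e k]
    by (simp add: inner_add_right ring_distribs)
  moreover have "norm (rest (d + e)) \<le> \<kappa> ^ k * (N k d + N k e)"
    using weighted_norm_components(3)[of d k] weighted_norm_components(3)[of e k]
      norm_triangle_ineq[of "rest d" "rest e"]
    by (simp add: rest_add ring_distribs)
  ultimately show ?thesis
    by (simp add: weighted_norm_le_iff)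
qed

text \<open>
  Since \<open>lam2\<^sup>k\<close> and \<open>\<kappa>\<^sup>k\<close> are at most 1, the constant does not depend on \<open>k\<close>. In the converse estimate
  below it does.
\<close>
lemma norm_le_weighted_norm: "norm d \<le> (norm z1 + m * norm z2 + 1) * N k d"
proof -
  have p: "lam2 ^ k \<le> 1" "\<kappa> ^ k \<le> 1"
    using lam \<kappa> by (auto intro: power_le_one)
  have "norm d \<le> \<bar>w1 \<bullet> d\<bar> * norm z1 + \<bar>w2 \<bullet> d\<bar> * norm z2 + norm (rest d)"
    by (subst (1) split[of d]) (intro order_trans[OF norm_triangle_ineq] add_mono, simp_all)
  also have "\<dots> \<le> N k d * norm z1 + m * 1 * N k d * norm z2 + 1 * N k d"
    using p m weighted_norm_nonneg[of k d]
    by (intro add_mono mult_right_mono order_trans[OF weighted_norm_components(2)[of d k]]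
        order_trans[OF weighted_norm_components(3)[of d k]] weighted_norm_components(1) mult_left_mono) auto
  finally show ?thesis
    by (simp add: algebra_simps)
qed

lemma weighted_norm_le_norm: "\<exists>B\<ge>0. \<forall>d. N k d \<le> B * norm d"
proof -
  obtain K where K: "\<And>v. norm (rest v) \<le> K * norm v" "K > 0"
    using linear_bounded_pos[OF rest_linear] by blast
  define B where "B = norm w1 + norm w2 / (m * lam2 ^ k) + K / \<kappa> ^ k"
  have pos: "0 < m * lam2 ^ k" "0 < \<kappa> ^ k"
    using m lam \<kappa> by simp_all
  have B: "norm w1 \<le> B" "norm w2 / (m * lam2 ^ k) \<le> B" "K / \<kappa> ^ k \<le> B"
    using pos K(2) by (simp_all add: B_def)
  have "N k d \<le> B * norm d" for d
  proof -
    have "\<bar>w1 \<bullet> d\<bar> \<le> B * norm d"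
      using Cauchy_Schwarz_ineq2[of w1 d] mult_right_mono[OF B(1), of "norm d"] by simp
    moreover have "\<bar>w2 \<bullet> d\<bar> \<le> m * lam2 ^ k * (B * norm d)"
    proof -
      have "norm w2 \<le> m * lam2 ^ k * B"
        using B(2) pos by (simp add: pos_divide_le_eq mult.commute)
      from mult_right_mono[OF this, of "norm d"] show ?thesis
        using Cauchy_Schwarz_ineq2[of w2 d] by simp
    qed
    moreover have "norm (rest d) \<le> \<kappa> ^ k * (B * norm d)"
    proof -
      have "K \<le> \<kappa> ^ k * B"
        using B(3) pos by (simp add: pos_divide_le_eq mult.commute)
      from mult_right_mono[OF this, of "norm d"] show ?thesis
        using K(1)[of d] by simp
    qed
    ultimately show ?thesis
      by (simp add: weighted_norm_le_iff)
  qed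
  moreover have "0 \<le> B"
    using B(1) norm_ge_zero[of w1] by linarith
  ultimately show ?thesis
    by blast
qed

end

lemma power_ratio_tendsto_0: "0 < a \<Longrightarrow> a < b \<Longrightarrow> (\<lambda>k. (a / b) ^ k) \<longlonglongrightarrow> (0::real)"
  by (intro LIMSEQ_power_zero) simp

text \<open>
  In the weighted coordinates the entries of the linear return map \<open>T k \<circ> Q\<close> tend to those of the
  antidiagonal matrix with entries \<open>b m\<close> and \<open>e / m\<close>: the growth \<open>lam1\<^sup>k\<close> in the first row meets \<open>lam2\<^sup>k\<close>
  from the second column, and the third column contributes only \<open>(lam1 \<kappa>)\<^sup>k = (\<kappa> / lam2)\<^sup>k\<close>. The entry
  that would be multiplied by \<open>lam1\<^sup>k\<close> alone vanishes.
\<close>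
lemma return_map_contraction:
  fixes Q :: "real ^ 'n ^ 'n"
  assumes m: "0 < m" and \<kappa>: "\<gamma> < \<kappa>" "\<kappa> < lam2"
    and Q11: "w1 \<bullet> (Q *v z1) = 0"
    and bm: "\<bar>w1 \<bullet> (Q *v z2)\<bar> * m < \<rho>" and em: "\<bar>w2 \<bullet> (Q *v z1)\<bar> / m < \<rho>"
  shows "\<forall>\<^sub>F k in sequentially. \<forall>d. weighted_norm m \<kappa> k (T k (Q *v d)) \<le> \<rho> * weighted_norm m \<kappa> k d"
proof -
  note \<kappa>0 = order.strict_trans[OF gap(1) \<kappa>(1)]
  note N = weighted_norm_le_iff[OF m \<kappa>0 \<kappa>(2)] weighted_norm_components[OF m \<kappa>0 \<kappa>(2)]
    weighted_norm_nonneg[OF m \<kappa>0 \<kappa>(2)] norm_le_weighted_norm[OF m \<kappa>0 \<kappa>(2)]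
  let ?N = "weighted_norm m \<kappa>"
  define b where "b = w1 \<bullet> (Q *v z2)"
  define e where "e = w2 \<bullet> (Q *v z1)"
  define f where "f = w2 \<bullet> (Q *v z2)"
  have "linear (\<lambda>d. rest (Q *v d))"
    using linear_compose[OF matrix_vector_mul_linear rest_linear, of Q] by (simp add: o_def)
  then obtain K1 where K1: "\<And>d. norm (rest (Q *v d)) \<le> K1 * norm d" "K1 > 0"
    using linear_bounded_pos by blast
  obtain KQ where KQ: "\<And>d. norm (Q *v d) \<le> KQ * norm d" "KQ > 0"
    using linear_bounded_pos[OF matrix_vector_mul_linear, of Q] by blast
  define K2 where "K2 = (norm w1 + norm w2) * KQ"
  have K2: "\<bar>w1 \<bullet> (Q *v d)\<bar> \<le> K2 * norm d" "\<bar>w2 \<bullet> (Q *v d)\<bar> \<le> K2 * norm d" for d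
  proof -
    have "\<bar>w \<bullet> (Q *v d)\<bar> \<le> K2 * norm d" if "norm w \<le> norm w1 + norm w2" for w
    proof -
      have "\<bar>w \<bullet> (Q *v d)\<bar> \<le> norm w * norm (Q *v d)"
        by (rule Cauchy_Schwarz_ineq2)
      also have "\<dots> \<le> (norm w1 + norm w2) * (KQ * norm d)"
        using that KQ by (intro mult_mono) auto
      finally show ?thesis
        by (simp add: K2_def mult.assoc)
    qed
    then show "\<bar>w1 \<bullet> (Q *v d)\<bar> \<le> K2 * norm d" "\<bar>w2 \<bullet> (Q *v d)\<bar> \<le> K2 * norm d"
      by simp_all
  qed
  have K20: "0 \<le> K2"
    using KQ by (simp add: K2_def)
  define A where "A = norm z1 + m * norm z2 + 1"
  have A: "0 \<le> A" "norm d \<le> A * ?N k d" for d k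
    using m N(6)[of d k] by (simp_all add: A_def add_nonneg_nonneg)
  \<comment> \<open>The three row sums of the rescaled matrix.\<close>
  define r1 where "r1 k = \<bar>b\<bar> * m + K2 * (\<kappa> / lam2) ^ k" for k
  define r2 where "r2 k = \<bar>e\<bar> / m + \<bar>f\<bar> * lam2 ^ k + K2 / m * \<kappa> ^ k" for k
  define r3 where "r3 k = C * K1 * A * (\<gamma> / \<kappa>) ^ k" for k
  have "r1 \<longlonglongrightarrow> \<bar>b\<bar> * m + K2 * 0" "r2 \<longlonglongrightarrow> \<bar>e\<bar> / m + \<bar>f\<bar> * 0 + K2 / m * 0" "r3 \<longlonglongrightarrow> C * K1 * A * 0"
    unfolding r1_def r2_def r3_def using \<kappa>0 \<kappa> lam gap
    by (intro tendsto_intros power_ratio_tendsto_0 LIMSEQ_power_zero; simp)+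
  then have "\<forall>\<^sub>F k in sequentially. r1 k < \<rho>" "\<forall>\<^sub>F k in sequentially. r2 k < \<rho>" "\<forall>\<^sub>F k in sequentially. r3 k < \<rho>"
    using bm em m
    by (auto simp: b_def e_def elim!: order_tendstoD(2) intro: order.strict_trans1[rotated])
  then show ?thesis
  proof eventually_elim
    case (elim k)
    show ?case
    proof
      fix d
      let ?q = "?N k d"
      have q: "0 \<le> ?q" "\<bar>w1 \<bullet> d\<bar> \<le> ?q" "\<bar>w2 \<bullet> d\<bar> \<le> m * lam2 ^ k * ?q" "norm (rest d) \<le> \<kappa> ^ k * ?q"
        using N by blast+
      have Qd: "Q *v d = (w1 \<bullet> d) *\<^sub>R (Q *v z1) + (w2 \<bullet> d) *\<^sub>R (Q *v z2) + Q *v rest d"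
        by (subst (1) split[of d]) (simp add: matrix_vector_right_distrib matrix_vector_mult_scaleR)
      have lk: "0 < lam2 ^ k" "0 < lam1 ^ k" "lam1 ^ k * lam2 ^ k = 1" "0 < \<kappa> ^ k"
        using lam \<kappa>0 lam_power by auto
      have "\<bar>w1 \<bullet> (Q *v d)\<bar> \<le> \<bar>b\<bar> * \<bar>w2 \<bullet> d\<bar> + K2 * norm (rest d)"
        using K2(1)[of "rest d"] Q11 unfolding Qd
        by (simp add: inner_add_right b_def abs_mult[symmetric] mult.commute)
      also have "\<dots> \<le> \<bar>b\<bar> * (m * lam2 ^ k * ?q) + K2 * (\<kappa> ^ k * ?q)"
        using q K20 by (intro add_mono mult_left_mono) auto
      also have "\<dots> = lam2 ^ k * (r1 k * ?q)"
        using lk lam by (simp add: r1_def field_simps)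
      finally have "lam1 ^ k * \<bar>w1 \<bullet> (Q *v d)\<bar> \<le> lam1 ^ k * (lam2 ^ k * (r1 k * ?q))"
        using lk by (intro mult_left_mono) auto
      also have "\<dots> = r1 k * ?q"
        using lk by (simp add: mult.assoc[symmetric])
      also have "\<dots> \<le> \<rho> * ?q"
        using elim q by (intro mult_right_mono) auto
      finally have c1: "\<bar>w1 \<bullet> T k (Q *v d)\<bar> \<le> \<rho> * ?q"
        using lk by (simp add: w_T abs_mult)
      have "\<bar>w2 \<bullet> (Q *v d)\<bar> \<le> \<bar>e\<bar> * \<bar>w1 \<bullet> d\<bar> + \<bar>f\<bar> * \<bar>w2 \<bullet> d\<bar> + K2 * norm (rest d)"
        using K2(2)[of "rest d"] unfolding Qd
        by (simp add: inner_add_right e_def f_def abs_mult[symmetric] mult.commute)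
      also have "\<dots> \<le> \<bar>e\<bar> * ?q + \<bar>f\<bar> * (m * lam2 ^ k * ?q) + K2 * (\<kappa> ^ k * ?q)"
        using q K20 by (intro add_mono mult_left_mono) auto
      also have "\<dots> = m * (r2 k * ?q)"
        using m by (simp add: r2_def field_simps)
      also have "\<dots> \<le> m * (\<rho> * ?q)"
        using elim q m by (intro mult_left_mono mult_right_mono) auto
      finally have c2: "\<bar>w2 \<bullet> T k (Q *v d)\<bar> \<le> m * lam2 ^ k * (\<rho> * ?q)"
        using lk by (simp add: w_T abs_mult mult_ac)
      have "norm (rest (T k (Q *v d))) \<le> C * \<gamma> ^ k * norm (rest (Q *v d))"
        by (rule norm_rest_T)
      also have "\<dots> \<le> C * \<gamma> ^ k * (K1 * (A * ?q))"
        using gap K1(2) by (intro mult_left_mono order_trans[OF K1(1)] A) auto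
      also have "\<dots> = \<kappa> ^ k * (r3 k * ?q)"
        using lk \<kappa>0 by (simp add: r3_def field_simps)
      also have "\<dots> \<le> \<kappa> ^ k * (\<rho> * ?q)"
        using elim q lk by (intro mult_left_mono mult_right_mono) auto
      finally have c3: "norm (rest (T k (Q *v d))) \<le> \<kappa> ^ k * (\<rho> * ?q)" .
      show "?N k (T k (Q *v d)) \<le> \<rho> * ?q"
        using c1 c2 c3 N(1) by blast
    qed
  qed
qed

section \<open>Fixed points of the return map\<close>

text \<open>
  The contraction makes \<open>id - T k \<circ> Q\<close> injective, so a fixed point exists. It is located by inserting an
  approximate solution \<open>q k\<close>, namely the fixed point of the limiting planar map in rescaled coordinates:
  the defect is small in the weighted norm, and the distance to the true fixed point is at most the defect
  divided by \<open>1 - \<rho>\<close>.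
\<close>
lemma return_map_fixed_points:
  fixes Q :: "real ^ 'n ^ 'n" and g :: "real ^ 'n"
  assumes Q11: "w1 \<bullet> (Q *v z1) = 0" and g: "w1 \<bullet> g = 0"
    and c: "c = - (w1 \<bullet> (Q *v z2)) * (w2 \<bullet> (Q *v z1))" "0 < c" "c < 1"
  shows "\<exists>d K. (\<forall>k\<ge>K. T k (g + Q *v d k) = d k) \<and>
     d \<longlonglongrightarrow> (w1 \<bullet> (Q *v z2) * (w2 \<bullet> g) / (1 + c)) *\<^sub>R z1 \<and>
     (\<forall>k\<ge>K. \<exists>B \<rho>. 0 < \<rho> \<and> \<rho> < 1 \<and> 0 \<le> B \<and>
       (\<forall>j v. norm (((\<lambda>v. T k (Q *v v)) ^^ j) v) \<le> B * \<rho> ^ j * norm v))"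
proof -
  define b where "b = w1 \<bullet> (Q *v z2)"
  define e where "e = w2 \<bullet> (Q *v z1)"
  define f where "f = w2 \<bullet> (Q *v z2)"
  have b0: "b \<noteq> 0"
    using c by (auto simp: b_def)
  have be: "\<bar>b\<bar> * \<bar>e\<bar> < 1"
    using c by (simp add: b_def e_def abs_mult[symmetric])
  \<comment> \<open>A weight with \<open>\<bar>e\<bar> < m < 1 / \<bar>b\<bar>\<close>, available because \<open>\<bar>b e\<bar> = c < 1\<close>, makes both antidiagonal
    entries smaller than 1.\<close>
  define m where "m = (\<bar>e\<bar> + 1 / \<bar>b\<bar>) / 2"
  have m: "0 < m" "\<bar>b\<bar> * m < 1" "\<bar>e\<bar> / m < 1"
  proof -
    have "\<bar>e\<bar> < 1 / \<bar>b\<bar>"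
      using be b0 by (simp add: pos_less_divide_eq mult.commute)
    then have "\<bar>e\<bar> < m" "m < 1 / \<bar>b\<bar>"
      by (simp_all add: m_def)
    then show "0 < m" "\<bar>b\<bar> * m < 1" "\<bar>e\<bar> / m < 1"
      using b0 by (auto simp: pos_less_divide_eq mult.commute pos_divide_less_eq)
  qed
  define \<kappa> where "\<kappa> = (\<gamma> + lam2) / 2"
  have \<kappa>: "\<gamma> < \<kappa>" "\<kappa> < lam2" "0 < \<kappa>"
    using gap by (auto simp: \<kappa>_def)
  note N = weighted_norm_le_iff[OF m(1) \<kappa>(3,2)] 
  note N_nonneg = weighted_norm_nonneg[OF m(1) \<kappa>(3,2)]
  note N_add = weighted_norm_add[OF m(1) \<kappa>(3,2)]
  define A where "A = norm z1 + m * norm z2 + 1"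
  have A: "norm d \<le> A * weighted_norm m \<kappa> k d" for d k
    unfolding A_def by (rule norm_le_weighted_norm[OF m(1) \<kappa>(3,2)])
  have A0: "0 < A"
    using m by (simp add: A_def add_nonneg_pos)
  let ?N = "weighted_norm m \<kappa>"
  define L where "L k = (\<lambda>v. T k (Q *v v))" for k
  have L_linear: "linear (L k)" for k
    using linear_compose[OF matrix_vector_mul_linear T_linear[of k], of Q] by (simp add: L_def o_def)
  define \<rho> where "\<rho> = (1 + max (\<bar>b\<bar> * m) (\<bar>e\<bar> / m)) / 2"
  have \<rho>: "\<bar>b\<bar> * m < \<rho>" "\<bar>e\<bar> / m < \<rho>" "\<rho> < 1" "0 < \<rho>"
  proof -
    have aux: "s < (1 + max s t) / 2 \<and> t < (1 + max s t) / 2 \<and> (1 + max s t) / 2 < 1 \<and> 0 < (1 + max s t) / 2"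
      if "0 \<le> s" "s < 1" "t < 1" for s t :: real
      using that by (auto simp: max_def)
    have "0 \<le> \<bar>b\<bar> * m"
      using m by simp
    then show "\<bar>b\<bar> * m < \<rho>" "\<bar>e\<bar> / m < \<rho>" "\<rho> < 1" "0 < \<rho>"
      using m aux[of "\<bar>b\<bar> * m" "\<bar>e\<bar> / m"] unfolding \<rho>_def by blast+
  qed
  obtain K where K: "\<And>k d. k \<ge> K \<Longrightarrow> ?N k (L k d) \<le> \<rho> * ?N k d"
    using return_map_contraction[OF m(1) \<kappa>(1,2) Q11 \<rho>(1,2)[unfolded b_def e_def]]
    by (auto simp: eventually_sequentially L_def)
  have decay_L: "\<exists>B \<rho>. 0 < \<rho> \<and> \<rho> < 1 \<and> 0 \<le> B \<and> (\<forall>j v. norm ((L k ^^ j) v) \<le> B * \<rho> ^ j * norm v)"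
    if k: "k \<ge> K" for k
  proof -
    obtain B where B: "B \<ge> 0" "\<And>d. ?N k d \<le> B * norm d"
      using weighted_norm_le_norm[OF m(1) \<kappa>(3,2)] by blast
    have iter: "?N k ((L k ^^ j) v) \<le> \<rho> ^ j * ?N k v" for j v
    proof (induction j)
      case (Suc j)
      have "?N k ((L k ^^ Suc j) v) \<le> \<rho> * ?N k ((L k ^^ j) v)"
        using K[OF k] by simp
      also have "\<dots> \<le> \<rho> * (\<rho> ^ j * ?N k v)"
        using Suc \<rho> by (intro mult_left_mono) auto
      finally show ?case
        by (simp add: mult.assoc)
    qed simp
    have "norm ((L k ^^ j) v) \<le> (A * B) * \<rho> ^ j * norm v" for j v
    proof -
      have "norm ((L k ^^ j) v) \<le> A * ?N k ((L k ^^ j) v)"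
        by (rule A)
      also have "\<dots> \<le> A * (\<rho> ^ j * (B * norm v))"
        using A0 \<rho> by (intro mult_left_mono order_trans[OF iter] B) auto
      finally show ?thesis
        by (simp add: mult_ac)
    qed
    moreover have "0 \<le> A * B"
      using A0 B by simp
    ultimately show ?thesis
      using \<rho> by (intro exI[of _ "A * B"] exI[of _ \<rho>]) auto
  qed
  have "\<exists>d. T k (g + Q *v d) = d" if k: "k \<ge> K" for k
  proof -
    have lin: "linear (\<lambda>d. d - L k d)"
      by (intro linear_compose_sub L_linear linear_ident)
    have "inj (\<lambda>d. d - L k d)"
    proof (subst linear_injective_0[OF lin], intro allI impI)
      fix d assume "d - L k d = 0"
      then have "?N k d \<le> \<rho> * ?N k d"
        using K[OF k, of d] by simp
      then have "(1 - \<rho>) * ?N k d \<le> 0"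
        by (simp add: algebra_simps)
      then have "?N k d \<le> 0"
        using \<rho> by (simp add: mult_le_0_iff)
      then have "A * ?N k d \<le> 0"
        using A0 by (simp add: mult_le_0_iff)
      then have "norm d \<le> 0"
        using A[of d k] by (rule order_trans[rotated])
      then show "d = 0"
        by simp
    qed
    then have "surj (\<lambda>d. d - L k d)"
      by (rule linear_injective_imp_surjective[OF lin]) (rule refl)
    then obtain d where "T k g = d - L k d"
      by (metis surjD)
    then have "T k (g + Q *v d) = d"
      by (simp add: linear_add[OF T_linear] L_def)
    then show ?thesis ..
  qed
  then obtain d where d: "\<And>k. k \<ge> K \<Longrightarrow> T k (g + Q *v d k) = d k"
    by metis
  define g2 where "g2 = w2 \<bullet> g"
  \<comment> \<open>The solution of \<open>u = b V\<close>, \<open>V = g2 + e u\<close>, where \<open>b e = - c\<close>.\<close>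
  define u where "u = b * g2 / (1 + c)"
  define V where "V = g2 + e * u"
  have bV: "b * V = u"
  proof -
    have "b * V = b * g2 - c * u"
      using c by (simp add: V_def b_def e_def algebra_simps)
    also have "b * g2 = (1 + c) * u"
      using c by (simp add: u_def)
    finally show ?thesis
      by (simp add: algebra_simps)
  qed
  define q where "q k = u *\<^sub>R z1 + (lam2 ^ k * V) *\<^sub>R z2" for k
  define r where "r k = T k (g + Q *v q k) - q k" for k
  define D where "D = norm (rest (g + u *\<^sub>R (Q *v z1))) + \<bar>V\<bar> * norm (rest (Q *v z2))"
  define s where "s k = \<bar>V * f\<bar> / m * lam2 ^ k + C * D * (\<gamma> / \<kappa>) ^ k" for k
  have Qq: "Q *v q k = u *\<^sub>R (Q *v z1) + (lam2 ^ k * V) *\<^sub>R (Q *v z2)" for k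
    by (simp add: q_def matrix_vector_right_distrib matrix_vector_mult_scaleR)
  have lk: "0 < lam2 ^ k" "lam2 ^ k \<le> 1" "0 < \<kappa> ^ k" "0 < \<gamma> ^ k" for k
    using lam \<kappa> gap by (auto intro: power_le_one)
  have D0: "0 \<le> D"
    by (simp add: D_def)
  have r: "?N k (r k) \<le> s k" for k
  proof -
    have s0: "0 \<le> \<bar>V * f\<bar> / m * lam2 ^ k" "0 \<le> C * D * (\<gamma> / \<kappa>) ^ k"
      using m lk gap \<kappa> D0 by simp_all
    have "w1 \<bullet> r k = lam1 ^ k * lam2 ^ k * (V * b) - u"
      unfolding r_def Qq unfolding q_def
      by (simp add: inner_diff_right w_T inner_add_right g Q11 normalised orthogonal b_def mult_ac)
    then have 1: "\<bar>w1 \<bullet> r k\<bar> \<le> s k"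
      using s0 bV lam_power[of k] by (simp add: s_def mult.commute)
    have "w2 \<bullet> r k = lam2 ^ k * (lam2 ^ k * (V * f))"
      unfolding r_def Qq unfolding q_def
      by (simp add: inner_diff_right w_T inner_add_right normalised orthogonal e_def f_def V_def g2_def
          algebra_simps)
    then have "\<bar>w2 \<bullet> r k\<bar> = m * lam2 ^ k * (\<bar>V * f\<bar> / m * lam2 ^ k)"
      using lk[of k] m by (simp add: abs_mult)
    also have "\<dots> \<le> m * lam2 ^ k * s k"
      using s0 lk[of k] m by (intro mult_left_mono) (auto simp: s_def)
    finally have 2: "\<bar>w2 \<bullet> r k\<bar> \<le> m * lam2 ^ k * s k" .
    have "rest (r k) = rest (T k (g + Q *v q k))"
      unfolding r_def by (simp add: q_def rest_diff rest_add rest_z)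
    then have "norm (rest (r k)) \<le> C * \<gamma> ^ k * norm (rest (g + Q *v q k))"
      using norm_rest_T by simp
    also have "\<dots> \<le> C * \<gamma> ^ k * D"
    proof (intro mult_left_mono)
      have "rest (g + Q *v q k) = rest (g + u *\<^sub>R (Q *v z1)) + (lam2 ^ k * V) *\<^sub>R rest (Q *v z2)"
        unfolding Qq by (simp add: add.assoc[symmetric] linear_cmul[OF rest_linear] rest_add)
      then have "norm (rest (g + Q *v q k)) \<le>
          norm (rest (g + u *\<^sub>R (Q *v z1))) + lam2 ^ k * \<bar>V\<bar> * norm (rest (Q *v z2))"
        using norm_triangle_ineq[of "rest (g + u *\<^sub>R (Q *v z1))" "(lam2 ^ k * V) *\<^sub>R rest (Q *v z2)"]
          lk[of k] by (simp add: abs_mult)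
      also have "\<dots> \<le> D"
        unfolding D_def using lk[of k] by (intro add_left_mono mult_right_mono mult_left_le_one_le) auto
      finally show "norm (rest (g + Q *v q k)) \<le> D" .
    qed (use gap lk in auto)
    also have "\<dots> = \<kappa> ^ k * (C * D * (\<gamma> / \<kappa>) ^ k)"
      using \<kappa> by (simp add: field_simps)
    also have "\<dots> \<le> \<kappa> ^ k * s k"
      using s0 lk[of k] by (intro mult_left_mono) (auto simp: s_def)
    finally have 3: "norm (rest (r k)) \<le> \<kappa> ^ k * s k" .
    show ?thesis
      using 1 2 3 by (simp add: N)
  qed
  have s_lim: "s \<longlonglongrightarrow> 0"
  proof -
    have "s \<longlonglongrightarrow> \<bar>V * f\<bar> / m * 0 + C * D * 0"
      unfolding s_def using lam gap \<kappa>
      by (intro tendsto_intros power_ratio_tendsto_0 LIMSEQ_power_zero) auto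
    then show ?thesis by simp
  qed
  have est: "norm (d k - u *\<^sub>R z1) \<le> A * (s k / (1 - \<rho>)) + lam2 ^ k * (\<bar>V\<bar> * norm z2)" if k: "k \<ge> K" for k
  proof -
    have "d k - q k = L k (d k - q k) + r k"
    proof -
      have "L k (d k - q k) + r k = T k (g + Q *v d k) - q k"
        by (simp add: L_def r_def matrix_vector_mult_diff_distrib linear_add[OF T_linear]
            linear_diff[OF T_linear])
      then show ?thesis
        using d[OF k] by simp
    qed
    then have "?N k (d k - q k) \<le> ?N k (L k (d k - q k)) + ?N k (r k)"
      using N_add[of k "L k (d k - q k)" "r k"] by simp
    also have "\<dots> \<le> \<rho> * ?N k (d k - q k) + s k"
      by (intro add_mono K[OF k] r)
    finally have "(1 - \<rho>) * ?N k (d k - q k) \<le> s k"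
      by (simp add: algebra_simps)
    then have n: "?N k (d k - q k) \<le> s k / (1 - \<rho>)"
      using \<rho> by (simp add: pos_le_divide_eq mult.commute)
    have "norm (d k - u *\<^sub>R z1) \<le> norm (d k - q k) + norm (q k - u *\<^sub>R z1)"
      using norm_triangle_ineq[of "d k - q k" "q k - u *\<^sub>R z1"] by simp
    also have "\<dots> \<le> A * (s k / (1 - \<rho>)) + lam2 ^ k * (\<bar>V\<bar> * norm z2)"
    proof (rule add_mono)
      show "norm (d k - q k) \<le> A * (s k / (1 - \<rho>))"
        using A0 by (intro order_trans[OF A[of _ k]] mult_left_mono n) auto
      show "norm (q k - u *\<^sub>R z1) \<le> lam2 ^ k * (\<bar>V\<bar> * norm z2)"
        using lam by (simp add: q_def abs_mult)
    qed
    finally show ?thesis .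
  qed
  have "(\<lambda>k. A * (s k / (1 - \<rho>)) + lam2 ^ k * (\<bar>V\<bar> * norm z2)) \<longlonglongrightarrow> A * (0 / (1 - \<rho>)) + 0 * (\<bar>V\<bar> * norm z2)"
    using \<rho> lam by (intro tendsto_intros s_lim LIMSEQ_power_zero) auto
  then have "(\<lambda>k. A * (s k / (1 - \<rho>)) + lam2 ^ k * (\<bar>V\<bar> * norm z2)) \<longlonglongrightarrow> 0"
    by simp
  then have "(\<lambda>k. d k - u *\<^sub>R z1) \<longlonglongrightarrow> 0"
    by (rule Lim_null_comparison[rotated]) (use est in \<open>auto simp: eventually_sequentially\<close>)
  then have "d \<longlonglongrightarrow> u *\<^sub>R z1"
    by (simp add: LIM_zero_iff)
  then have "d \<longlonglongrightarrow> (w1 \<bullet> (Q *v z2) * (w2 \<bullet> g) / (1 + c)) *\<^sub>R z1"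
    by (simp only: u_def b_def g2_def)
  then show ?thesis
    using d decay_L[unfolded L_def] by (intro exI[of _ d] exI[of _ K] conjI allI impI)
qed

section \<open>Orbit segments between two passages\<close>

text \<open>
  The orbit segment from \<open>h k\<close> to \<open>T k (h k)\<close> follows the forward orbit of \<open>h0\<close> for a bounded number of
  steps at the beginning and the backward orbit of \<open>u z1\<close> for a bounded number of steps at the end. In
  between both \<open>lam2\<^sup>j\<close> and \<open>lam2\<^sup>k\<^sup>-\<^sup>j\<close> are small, and the segment is close to \<open>0\<close>. Only finitely many
  conditions on convergent sequences remain, which gives a bound on \<open>k\<close> that is uniform in \<open>j\<close>.
\<close>
lemma return_orbit_in_open_set:
  assumes G: "open G" "0 \<in> G"
    and h: "h \<longlonglongrightarrow> h0" and fwd: "\<And>j. T j h0 \<in> G"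
    and d: "(\<lambda>k. T k (h k)) \<longlonglongrightarrow> u *\<^sub>R z1" and bwd: "\<And>i. i > 0 \<Longrightarrow> (u / lam1 ^ i) *\<^sub>R z1 \<in> G"
  shows "\<forall>\<^sub>F k in sequentially. \<forall>j<k. T j (h k) \<in> G"
proof -
  obtain \<epsilon> where \<epsilon>: "0 < \<epsilon>" "\<And>v. norm v < \<epsilon> \<Longrightarrow> v \<in> G"
    using G by (auto simp: open_contains_ball subset_eq dist_norm)
  \<comment> \<open>The unstable component is expressed by the end of the segment, the stable ones by its beginning.\<close>
  have decomposition: "T j (h k) = (lam2 ^ (k - j) * (w1 \<bullet> T k (h k))) *\<^sub>R z1
      + (lam2 ^ j * (w2 \<bullet> h k)) *\<^sub>R z2 + T j (rest (h k))" if "j \<le> k" for j k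
  proof -
    have "lam2 ^ (k - j) * (lam1 ^ k * (w1 \<bullet> h k)) = lam1 ^ j * (w1 \<bullet> h k)"
    proof -
      have "lam1 ^ k = lam1 ^ (k - j) * lam1 ^ j"
        using that by (simp flip: power_add)
      then show ?thesis
        using lam_power[of "k - j"] by (simp add: mult_ac)
    qed
    then show ?thesis
      using T_split[of j "h k"] by (auto simp: w_T)
  qed
  have w1_lim: "(\<lambda>k. w1 \<bullet> T k (h k)) \<longlonglongrightarrow> u"
    using tendsto_inner[OF tendsto_const d, of w1] by (simp add: normalised)
  have w2_lim: "(\<lambda>k. w2 \<bullet> h k) \<longlonglongrightarrow> w2 \<bullet> h0"
    by (intro tendsto_intros h)
  have rest_lim: "(\<lambda>k. rest (h k)) \<longlonglongrightarrow> rest h0"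
    using linear_continuous_at[OF linear_conv_bounded_linear[THEN iffD1, OF rest_linear]] h
    by (rule isCont_tendsto_compose)
  define H where "H = (\<bar>u\<bar> + 1) * norm z1 + (\<bar>w2 \<bullet> h0\<bar> + 1) * norm z2 + C * (norm (rest h0) + 1)"
  have H: "0 \<le> H" "(\<bar>u\<bar> + 1) * norm z1 \<le> H"
    "(\<bar>w2 \<bullet> h0\<bar> + 1) * norm z2 + C * (norm (rest h0) + 1) \<le> H"
    using gap by (simp_all add: H_def)
  have "(\<lambda>J. 2 * H * lam2 ^ J) \<longlonglongrightarrow> 2 * H * 0"
    using lam by (intro tendsto_intros LIMSEQ_power_zero) auto
  then have "\<forall>\<^sub>F J in sequentially. 2 * H * lam2 ^ J < \<epsilon>"
    using \<epsilon>(1) by (auto elim!: order_tendstoD(2))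
  then obtain J where J: "2 * H * lam2 ^ J < \<epsilon>"
    by (auto simp: eventually_sequentially)
  have "\<forall>\<^sub>F k in sequentially. \<forall>j\<in>{..<J}. T j (h k) \<in> G"
  proof (rule eventually_ball_finite, simp, intro ballI)
    fix j
    have "(\<lambda>k. T j (h k)) \<longlonglongrightarrow> T j h0"
      using linear_continuous_at[OF linear_conv_bounded_linear[THEN iffD1, OF T_linear]] h
      by (rule isCont_tendsto_compose)
    then show "\<forall>\<^sub>F k in sequentially. T j (h k) \<in> G"
      using G(1) fwd by (rule topological_tendstoD)
  qed
  moreover have "\<forall>\<^sub>F k in sequentially. \<forall>i\<in>{1..J}. i \<le> k \<longrightarrow> T (k - i) (h k) \<in> G"
  proof (rule eventually_ball_finite, simp, intro ballI)
    fix i assume "i \<in> {1..J}"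
    then have i: "0 < i" by simp
    let ?q = "\<lambda>k. (lam2 ^ i * (w1 \<bullet> T k (h k))) *\<^sub>R z1 + (lam2 ^ (k - i) * (w2 \<bullet> h k)) *\<^sub>R z2 + T (k - i) (rest (h k))"
    have ki: "filterlim (\<lambda>k. k - i) sequentially sequentially"
      by (rule filterlim_minus_const_nat_at_top)
    have pow: "(\<lambda>k. r ^ (k - i)) \<longlonglongrightarrow> 0" if "0 < r" "r < 1" for r :: real
      using that by (intro filterlim_compose[OF LIMSEQ_power_zero ki]) auto
    have "(\<lambda>k. C * \<gamma> ^ (k - i) * norm (rest (h k))) \<longlonglongrightarrow> C * 0 * norm (rest h0)"
      using gap lam by (intro tendsto_intros rest_lim pow) auto
    then have lim: "(\<lambda>k. C * \<gamma> ^ (k - i) * norm (rest (h k))) \<longlonglongrightarrow> 0"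
      by simp
    have "(\<lambda>k. T (k - i) (rest (h k))) \<longlonglongrightarrow> 0"
      by (rule Lim_null_comparison[OF _ lim]) (intro always_eventually allI decay rest_kernel)
    then have "?q \<longlonglongrightarrow> (lam2 ^ i * u) *\<^sub>R z1 + (0 * (w2 \<bullet> h0)) *\<^sub>R z2 + 0"
      using lam by (intro tendsto_intros w1_lim w2_lim pow) auto
    moreover have "lam2 ^ i * u = u / lam1 ^ i"
      using lam_power[of i] lam by (simp add: field_simps)
    ultimately have "?q \<longlonglongrightarrow> (u / lam1 ^ i) *\<^sub>R z1"
      by simp
    then have "\<forall>\<^sub>F k in sequentially. ?q k \<in> G"
      using G(1) bwd[OF i] by (rule topological_tendstoD)
    then show "\<forall>\<^sub>F k in sequentially. i \<le> k \<longrightarrow> T (k - i) (h k) \<in> G"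
    proof eventually_elim
      case (elim k)
      then show ?case
        using decomposition[of "k - i" k] by auto
    qed
  qed
  moreover have "\<forall>\<^sub>F k in sequentially. \<bar>w1 \<bullet> T k (h k)\<bar> < \<bar>u\<bar> + 1"
    by (rule order_tendstoD(2)[OF tendsto_rabs[OF w1_lim]]) simp
  moreover have "\<forall>\<^sub>F k in sequentially. \<bar>w2 \<bullet> h k\<bar> < \<bar>w2 \<bullet> h0\<bar> + 1"
    by (rule order_tendstoD(2)[OF tendsto_rabs[OF w2_lim]]) simp
  moreover have "\<forall>\<^sub>F k in sequentially. norm (rest (h k)) < norm (rest h0) + 1"
    by (rule order_tendstoD(2)[OF tendsto_norm[OF rest_lim]]) simp
  ultimately show ?thesis
  proof eventually_elim
    case (elim k)
    show ?case
    proof (intro allI impI)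
      fix j assume j: "j < k"
      consider "j < J" | "k - j \<in> {1..J}" | "J \<le> j" "J \<le> k - j"
        using j by fastforce
      then show "T j (h k) \<in> G"
      proof cases
        case 1
        then show ?thesis using elim by simp
      next
        case 2
        moreover have "k - (k - j) = j" "k - j \<le> k"
          using j by simp_all
        ultimately show ?thesis
          using elim(2) by metis
      next
        case 3
        have p: "lam2 ^ (k - j) \<le> lam2 ^ J" "lam2 ^ j \<le> lam2 ^ J" "\<gamma> ^ j \<le> lam2 ^ j"
          using lam gap 3 by (auto intro: power_decreasing power_mono)
        have pos: "0 \<le> lam2 ^ i" "0 \<le> \<gamma> ^ i" for i
          using lam gap by simp_all
        have "norm (T j (h k)) \<le> lam2 ^ (k - j) * \<bar>w1 \<bullet> T k (h k)\<bar> * norm z1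
            + lam2 ^ j * \<bar>w2 \<bullet> h k\<bar> * norm z2 + C * \<gamma> ^ j * norm (rest (h k))"
          using pos
          by (subst decomposition[OF less_imp_le[OF j]])
            (intro order_trans[OF norm_triangle_ineq] add_mono decay rest_kernel, simp_all add: abs_mult)
        also have "\<dots> \<le> lam2 ^ J * (\<bar>u\<bar> + 1) * norm z1
            + lam2 ^ J * (\<bar>w2 \<bullet> h0\<bar> + 1) * norm z2 + C * lam2 ^ J * (norm (rest h0) + 1)"
          using p pos elim(3-5) gap order_trans[OF p(3,2)]
          by (intro add_mono mult_mono mult_nonneg_nonneg) (auto simp: less_imp_le)
        also have "\<dots> = H * lam2 ^ J"
          by (simp add: H_def algebra_simps)
        also have "\<dots> \<le> 2 * H * lam2 ^ J"
          using H(1) pos by simp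
        also have "\<dots> < \<epsilon>"
          by (rule J)
        finally show ?thesis
          by (rule \<epsilon>(2))
      qed
    qed
  qed
qed

end

section \<open>Words and strictly admissible cycles\<close>

definition strictly_agrees :: "'n \<Rightarrow> letter \<Rightarrow> real ^ 'n::finite \<Rightarrow> bool" where
  "strictly_agrees i1 s x \<longleftrightarrow> agrees_with_sign i1 s x \<and> x $ i1 \<noteq> 0"

lemma strictly_agrees_iff:
  "strictly_agrees i1 s x \<longleftrightarrow> (case s of L \<Rightarrow> x $ i1 < 0 | R \<Rightarrow> x $ i1 > 0)"
  by (auto simp: strictly_agrees_def agrees_with_sign_def split: letter.split)

lemma open_strictly_agrees: "open {x. strictly_agrees i1 s x}"
  by (cases s) (simp_all add: strictly_agrees_iff open_Collect_less continuous_on_component)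

lemma pwl_map_eq_letter_map:
  assumes "strictly_agrees i1 s x"
  shows "pwl_map i1 A_L A_R b x = letter_map A_L A_R b s x"
  using assms by (cases s) (simp_all add: strictly_agrees_iff pwl_map_def)

lemma letter_map_on_switching_manifold:
  assumes "A_R = A_L + (\<chi> i j. \<xi> $ i * axis i1 1 $ j)" "x $ i1 = 0"
  shows "letter_map A_L A_R b s x = letter_map A_L A_R b t x"
proof -
  have "A_R *v x = A_L *v x"
    using assms(2) unfolding assms(1)
    by (simp add: vec_eq_iff matrix_vector_mult_def axis_def distrib_right sum.distrib
        if_distrib[of "\<lambda>x. _ * x"] if_distrib[of "\<lambda>x. x * _"] cong: if_cong)
  then show ?thesis
    by (cases s; cases t) (simp_all add: letter_map_def letter_matrix_def)
qed

lemma letter_map_add: "letter_map A_L A_R b s (x + d) = letter_map A_L A_R b s x + letter_matrix A_L A_R s *v d"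
  by (simp add: letter_map_def matrix_vector_right_distrib)

lemma word_map_add: "word_map A_L A_R b Z (x + d) = word_map A_L A_R b Z x + word_matrix A_L A_R Z *v d"
  by (induction Z arbitrary: x d) (simp_all add: letter_map_add matrix_vector_mul_assoc)

lemma word_map_append: "word_map A_L A_R b (Z @ W) x = word_map A_L A_R b W (word_map A_L A_R b Z x)"
  by (induction Z arbitrary: x) simp_all

lemma word_matrix_append: "word_matrix A_L A_R (Z @ W) = word_matrix A_L A_R W ** word_matrix A_L A_R Z"
  by (induction Z) (simp_all add: matrix_mul_assoc)

lemma word_map_power: "word_map A_L A_R b (word_power X k) = word_map A_L A_R b X ^^ k"
  by (induction k) (simp_all add: word_power_def fun_eq_iff word_map_append funpow_swap1)

lemma word_matrix_power: "(*v) (word_matrix A_L A_R (word_power X k)) = (*v) (word_matrix A_L A_R X) ^^ k"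
proof (induction k)
  case (Suc k)
  have "word_power X (Suc k) = X @ word_power X k"
    by (simp add: word_power_def)
  then show ?case
    using Suc by (simp add: word_matrix_append fun_eq_iff matrix_vector_mul_assoc[symmetric] funpow_swap1)
qed (simp add: word_power_def fun_eq_iff)

lemma length_word_power: "length (word_power X k) = k * length X"
  by (simp add: word_power_def length_concat sum_list_replicate)

lemma word_map_take_Suc:
  "i < length Z \<Longrightarrow> word_map A_L A_R b (take (Suc i) Z) x = letter_map A_L A_R b (Z ! i) (word_map A_L A_R b (take i Z) x)"
  by (simp add: take_Suc_conv_app_nth word_map_append)

lemma word_matrix_take_Suc:
  "i < length Z \<Longrightarrow> word_matrix A_L A_R (take (Suc i) Z) = letter_matrix A_L A_R (Z ! i) ** word_matrix A_L A_R (take i Z)"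
  by (simp add: take_Suc_conv_app_nth word_matrix_append)

lemma continuous_on_word_map: "continuous_on S (word_map A_L A_R b Z)"
proof -
  have "word_map A_L A_R b Z x = word_map A_L A_R b Z 0 + word_matrix A_L A_R Z *v x" for x
    using word_map_add[of A_L A_R b Z 0 x] by (simp only: add_0)
  then have eq: "word_map A_L A_R b Z = (\<lambda>x. word_map A_L A_R b Z 0 + word_matrix A_L A_R Z *v x)"
    by (rule ext)
  have "continuous_on S (\<lambda>x. word_map A_L A_R b Z 0 + word_matrix A_L A_R Z *v x)"
    by (intro continuous_on_add continuous_on_const matrix_vector_mult_linear_continuous_on)
  then show ?thesis
    by (subst eq)
qed

lemma strict_cycle:
  fixes A_L A_R :: "real ^ 'n::finite ^ 'n" and b z :: "real ^ 'n" and W :: "letter list"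
  defines "zs \<equiv> \<lambda>i. word_map A_L A_R b (take i W) z"
  assumes fixed: "word_map A_L A_R b W z = z"
    and strict: "\<And>i. i < length W \<Longrightarrow> strictly_agrees i1 (W ! i) (zs i)"
  shows "admissible_cycle i1 A_L A_R b W zs"
    and "cycle_points W zs \<inter> switching_manifold i1 = {}"
proof -
  have "is_cycle A_L A_R b W zs"
    unfolding is_cycle_def
  proof (intro allI impI)
    fix i assume i: "i < length W"
    then have "letter_map A_L A_R b (W ! i) (zs i) = zs (Suc i)"
      by (simp add: zs_def word_map_take_Suc)
    moreover have "zs (length W) = zs 0"
      by (simp add: zs_def fixed)
    ultimately show "letter_map A_L A_R b (W ! i) (zs i) = zs ((i + 1) mod length W)"
      using i by (cases "Suc i = length W") auto
  qed
  moreover have "(pwl_map i1 A_L A_R b ^^ i) (zs 0) = zs i" if "i \<le> length W" for i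
    using that
  proof (induction i)
    case (Suc i)
    then show ?case
      using pwl_map_eq_letter_map[OF strict[of i]] by (simp add: zs_def word_map_take_Suc)
  qed simp
  then have "follows i1 A_L A_R b W (zs 0)"
    using strict by (simp add: follows_def strictly_agrees_def)
  ultimately show "admissible_cycle i1 A_L A_R b W zs"
    by (simp add: admissible_cycle_def)
  show "cycle_points W zs \<inter> switching_manifold i1 = {}"
    using strict by (auto simp: cycle_points_def switching_manifold_def strictly_agrees_def)
qed

lemma strictly_agrees_perturb:
  assumes "strictly_agrees i1 s x" "norm d < \<bar>x $ i1\<bar>"
  shows "strictly_agrees i1 s (x + d)"
proof -
  have "\<bar>d $ i1\<bar> < \<bar>x $ i1\<bar>"
    using component_le_norm_cart[of d i1] assms(2) by linarith
  then show ?thesis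
    using assms(1) by (cases s) (auto simp: strictly_agrees_iff)
qed

text \<open>
  All cycle points have distance at least \<open>\<eta> > 0\<close> from the switching manifold, and the affine word map moves
  nearby points along the cycle with deviations \<open>D j v\<close> of size at most \<open>E * norm v\<close>. So points with
  \<open>norm v < \<eta> / E\<close> keep the symbols of the cycle forever, and their deviations are exactly the linear ones.
\<close>
lemma strict_cycle_asymptotically_stable:
  fixes z :: "real ^ 'n::finite"
  assumes W: "W \<noteq> []" and fixed: "word_map A_L A_R b W z = z"
    and strict: "\<And>i. i < length W \<Longrightarrow> strictly_agrees i1 (W ! i) (word_map A_L A_R b (take i W) z)"
    and \<rho>: "0 \<le> \<rho>" "\<rho> < 1" and B: "0 \<le> B"
    and decay: "\<And>j v. norm (((*v) (word_matrix A_L A_R W) ^^ j) v) \<le> B * \<rho> ^ j * norm v"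
  shows "asymptotically_stable (pwl_map i1 A_L A_R b) z"
proof -
  let ?m = "length W"
  let ?f = "pwl_map i1 A_L A_R b"
  have m: "0 < ?m"
    using W by simp
  define zs where "zs j = word_map A_L A_R b (take (j mod ?m) W) z" for j
  define D where "D j v = word_matrix A_L A_R (take (j mod ?m) W) *v (((*v) (word_matrix A_L A_R W) ^^ (j div ?m)) v)" for j v
  have step_z: "letter_map A_L A_R b (W ! (j mod ?m)) (zs j) = zs (Suc j)" for j
  proof (cases "Suc (j mod ?m) = ?m")
    case True
    then have "letter_map A_L A_R b (W ! (j mod ?m)) (zs j) = word_map A_L A_R b (take ?m W) z"
      using word_map_take_Suc[of "j mod ?m" W A_L A_R b z] m by (simp add: zs_def)
    then show ?thesis
      using True fixed by (simp add: zs_def mod_Suc)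
  next
    case False
    then show ?thesis
      using word_map_take_Suc[of "j mod ?m" W A_L A_R b z] m by (simp add: zs_def mod_Suc)
  qed
  have step_D: "letter_matrix A_L A_R (W ! (j mod ?m)) *v D j v = D (Suc j) v" for j v
  proof (cases "Suc (j mod ?m) = ?m")
    case True
    then have "letter_matrix A_L A_R (W ! (j mod ?m)) *v D j v =
        word_matrix A_L A_R (take ?m W) *v (((*v) (word_matrix A_L A_R W) ^^ (j div ?m)) v)"
      using word_matrix_take_Suc[of "j mod ?m" W A_L A_R] m by (simp add: D_def matrix_vector_mul_assoc)
    then show ?thesis
      using True by (simp add: D_def mod_Suc div_Suc)
  next
    case False
    then show ?thesis
      using word_matrix_take_Suc[of "j mod ?m" W A_L A_R] m
      by (simp add: D_def mod_Suc div_Suc matrix_vector_mul_assoc)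
  qed
  have "\<exists>K>0. \<forall>v. norm (word_matrix A_L A_R (take r W) *v v) \<le> K * norm v" for r
    using linear_bounded_pos[OF matrix_vector_mul_linear, of "word_matrix A_L A_R (take r W)"] by blast
  then obtain K where K: "\<And>r. K r > 0" "\<And>r v. norm (word_matrix A_L A_R (take r W) *v v) \<le> K r * norm v"
    by metis
  define E where "E = (\<Sum>r<?m. K r) * B + 1"
  have sumK: "0 \<le> (\<Sum>r<?m. K r)"
    using K(1) by (intro sum_nonneg) (simp add: less_imp_le)
  then have E: "0 < E"
    using B by (simp add: E_def add_nonneg_pos)
  have D_bound: "norm (D j v) \<le> E * \<rho> ^ (j div ?m) * norm v" for j v
  proof -
    have "norm (D j v) \<le> K (j mod ?m) * (B * \<rho> ^ (j div ?m) * norm v)"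
      unfolding D_def using K(1)[of "j mod ?m"]
      by (intro order_trans[OF K(2)] mult_left_mono decay) auto
    also have "\<dots> \<le> (\<Sum>r<?m. K r) * (B * \<rho> ^ (j div ?m) * norm v)"
      using m K(1) B \<rho> by (intro mult_right_mono member_le_sum) (auto simp: less_imp_le)
    also have "\<dots> = ((\<Sum>r<?m. K r) * B) * (\<rho> ^ (j div ?m) * norm v)"
      by (simp add: mult_ac)
    also have "\<dots> \<le> E * (\<rho> ^ (j div ?m) * norm v)"
      using \<rho> by (intro mult_right_mono) (auto simp: E_def)
    finally show ?thesis
      by (simp add: mult_ac)
  qed
  have D_bound': "norm (D j v) \<le> E * norm v" for j v
  proof -
    have "E * \<rho> ^ (j div ?m) * norm v \<le> E * 1 * norm v"
      using E \<rho> by (intro mult_right_mono mult_left_mono power_le_one) auto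
    then show ?thesis
      using D_bound[of j v] by simp
  qed
  define \<eta> where "\<eta> = Min ((\<lambda>i. \<bar>zs i $ i1\<bar>) ` {..<?m})"
  have \<eta>: "0 < \<eta>" "\<And>j. \<eta> \<le> \<bar>zs j $ i1\<bar>"
  proof -
    have zs_mod: "zs j = zs (j mod ?m)" for j
      by (simp add: zs_def)
    show "0 < \<eta>"
      unfolding \<eta>_def by (subst Min_gr_iff) (use m strict in \<open>auto simp: zs_def strictly_agrees_def\<close>)
    show "\<eta> \<le> \<bar>zs j $ i1\<bar>" for j
      unfolding \<eta>_def by (subst zs_mod) (use m in \<open>auto intro!: Min_le\<close>)
  qed
  have orbit: "(?f ^^ j) (z + v) = zs j + D j v" if v: "norm v < \<eta> / E" for j v
  proof (induction j)
    case 0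
    show ?case by (simp add: zs_def D_def)
  next
    case (Suc j)
    have "norm (D j v) < \<eta>"
      using v E D_bound'[of j v] by (simp add: pos_less_divide_eq mult.commute)
    then have "strictly_agrees i1 (W ! (j mod ?m)) (zs j + D j v)"
      using strict[of "j mod ?m"] m \<eta>(2)[of j] by (intro strictly_agrees_perturb) (auto simp: zs_def)
    then have "?f (zs j + D j v) = zs (Suc j) + D (Suc j) v"
      by (simp add: pwl_map_eq_letter_map letter_map_add step_z step_D)
    then show ?case
      using Suc by simp
  qed
  have orbit0: "(?f ^^ j) z = zs j" for j
  proof -
    have "D j 0 = 0"
      using D_bound'[of j 0] by simp
    then show ?thesis
      using orbit[of 0 j] \<eta> E by simp
  qed
  have dist: "dist ((?f ^^ j) u) ((?f ^^ j) z) \<le> E * \<rho> ^ (j div ?m) * dist u z"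
      "dist ((?f ^^ j) u) ((?f ^^ j) z) \<le> E * dist u z" if "dist u z < \<eta> / E" for u j
    using orbit[of "u - z" j] orbit0[of j] D_bound[of j "u - z"] D_bound'[of j "u - z"] that
    by (simp_all add: dist_norm)
  show ?thesis
    unfolding asymptotically_stable_def
  proof (intro conjI allI impI)
    fix \<epsilon> :: real assume "0 < \<epsilon>"
    show "\<exists>\<delta>>0. \<forall>u. dist u z < \<delta> \<longrightarrow> (\<forall>j. dist ((?f ^^ j) u) ((?f ^^ j) z) < \<epsilon>)"
    proof (intro exI[of _ "min (\<eta> / E) (\<epsilon> / E)"] conjI allI impI)
      fix u j assume "dist u z < min (\<eta> / E) (\<epsilon> / E)"
      then show "dist ((?f ^^ j) u) ((?f ^^ j) z) < \<epsilon>"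
        using dist(2)[of u j] E by (simp add: pos_less_divide_eq mult.commute)
    qed (use \<eta> E \<open>0 < \<epsilon>\<close> in auto)
  next
    have "filterlim (\<lambda>j. j div ?m) sequentially sequentially"
      using m by (simp add: filterlim_at_top_div_const_nat)
    then have "(\<lambda>j. \<rho> ^ (j div ?m)) \<longlonglongrightarrow> 0"
      using \<rho> by (intro filterlim_compose[OF LIMSEQ_power_zero]) auto
    then have lim: "(\<lambda>j. E * \<rho> ^ (j div ?m) * dist u z) \<longlonglongrightarrow> 0" for u
      by (auto intro!: tendsto_eq_intros)
    show "\<exists>\<delta>>0. \<forall>u. dist u z < \<delta> \<longrightarrow> (\<lambda>j. dist ((?f ^^ j) u) ((?f ^^ j) z)) \<longlonglongrightarrow> 0"
    proof (intro exI[of _ "\<eta> / E"] conjI allI impI)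
      fix u assume "dist u z < \<eta> / E"
      then show "(\<lambda>j. dist ((?f ^^ j) u) ((?f ^^ j) z)) \<longlonglongrightarrow> 0"
        by (intro Lim_null_comparison[OF _ lim[of u]]) (auto intro!: always_eventually dist(1))
    qed (use \<eta> E in auto)
  qed
qed

lemma word_power_split:
  assumes "j < k"
  shows "word_power X k = word_power X j @ X @ word_power X (k - Suc j)"
proof -
  have "replicate k X = replicate j X @ X # replicate (k - Suc j) X"
    using assms by (metis Suc_diff_Suc add_diff_inverse_nat less_imp_not_less replicate_Suc replicate_add)
  then show ?thesis
    by (simp add: word_power_def)
qed

section \<open>Symbol sequences and bounded orbits\<close>

lemma homoclinic_sequence_neg:
  "r < length X \<Longrightarrow> homoclinic_sequence X Y (int r - int (Suc j * length X)) = X ! r"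
proof -
  assume r: "r < length X"
  have "int (length X) \<le> int (Suc j * length X)"
    by (simp only: of_nat_le_iff) simp
  then have "int r - int (Suc j * length X) < 0"
    using r by linarith
  moreover have "(int r - int (Suc j * length X)) mod int (length X) = int r mod int (length X)"
  proof -
    have "int r - int (Suc j * length X) = int r + - int (Suc j) * int (length X)"
      by (simp add: algebra_simps)
    then show ?thesis
      by (simp only: mod_mult_self1)
  qed
  ultimately show ?thesis
    using r by (simp add: homoclinic_sequence_def)
qed

lemma homoclinic_sequence_middle: "r < length Y \<Longrightarrow> homoclinic_sequence X Y (int r) = Y ! r"
  by (simp add: homoclinic_sequence_def)

lemma homoclinic_sequence_pos:
  "r < length X \<Longrightarrow> homoclinic_sequence X Y (int (length Y) + int (j * length X) + int r) = X ! r"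
proof -
  assume r: "r < length X"
  let ?i = "int (length Y) + int (j * length X) + int r"
  have "?i - int (length Y) = int r + int j * int (length X)"
    by simp
  then have "(?i - int (length Y)) mod int (length X) = int r"
    using r by (simp only: mod_mult_self1) simp
  moreover have "\<not> ?i < 0" "\<not> ?i < int (length Y)"
    by (simp_all add: not_less add_nonneg_nonneg)
  ultimately show ?thesis
    unfolding homoclinic_sequence_def by (simp only: if_False nat_int)
qed

text \<open>
  The block at indices \<open>- length X, \<dots>\<close> reads \<open>X @ Y\<close>, the one at indices \<open>0, \<dots>\<close> reads \<open>Y @ X\<close>, and these
  words differ in the two flipped letters only.
\<close>
lemma homoclinic_sequence_shift:
  assumes words: "X @ Y = flip_at \<alpha> (flip_at 0 (Y @ X))"
    and i: "i + int (length X) \<noteq> 0" "i + int (length X) \<noteq> int \<alpha>"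
  shows "homoclinic_sequence X Y (i + int (length X)) = homoclinic_sequence X Y i"
proof -
  let ?n = "int (length X)" and ?p = "int (length Y)"
  consider "i + ?n < 0" | "0 \<le> i + ?n" "i < ?p" | "?p \<le> i" by linarith
  then show ?thesis
  proof cases
    case 1
    then show ?thesis by (simp add: homoclinic_sequence_def)
  next
    case 2
    define t where "t = nat (i + ?n)"
    have t: "i = int t - ?n" "t < length X + length Y" "t \<noteq> 0" "t \<noteq> \<alpha>"
      using 2 i by (auto simp: t_def)
    have "homoclinic_sequence X Y i = (X @ Y) ! t"
    proof (cases "t < length X")
      case True
      then show ?thesis
        using homoclinic_sequence_neg[of t X Y 0] t(1) by (simp add: nth_append)
    next
      case False
      then show ?thesis
        using t homoclinic_sequence_middle[of "t - length X" Y X]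
        by (simp add: nth_append of_nat_diff)
    qed
    also have "\<dots> = (Y @ X) ! t"
      unfolding words using t by (simp add: flip_at_def)
    also have "\<dots> = homoclinic_sequence X Y (int t)"
    proof (cases "t < length Y")
      case True
      then show ?thesis
        by (simp add: homoclinic_sequence_middle nth_append)
    next
      case False
      then show ?thesis
        using homoclinic_sequence_pos[of "t - length Y" X Y 0] t by (simp add: nth_append of_nat_diff)
    qed
    finally show ?thesis
      using t(1) by simp
  next
    case 3
    then show ?thesis
      by (simp add: homoclinic_sequence_def algebra_simps)
        (metis add_diff_eq mod_add_self1 add.commute)
  qed
qed

lemma orbit_along_word:
  assumes orbit: "is_orbit A_L A_R b S y" and W: "\<And>r. r < length W \<Longrightarrow> S (i + int r) = W ! r"
  shows "r \<le> length W \<Longrightarrow> y (i + int r) = word_map A_L A_R b (take r W) (y i)"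
proof (induction r)
  case (Suc r)
  have "y (i + int (Suc r)) = letter_map A_L A_R b (S (i + int r)) (y (i + int r))"
  proof -
    have "i + int (Suc r) = i + int r + 1"
      by simp
    then show ?thesis
      using orbit[unfolded is_orbit_def, rule_format, of "i + int r"] by (simp only:)
  qed
  then show ?case
    using Suc W[of r] by (simp add: word_map_take_Suc)
qed simp

lemma homoclinic_orbit_bounded:
  fixes y :: "int \<Rightarrow> 'a::euclidean_space"
  assumes C: "finite C" "C \<noteq> {}" and y: "homoclinic_to C y"
  obtains B I where "\<And>i. i \<ge> int I \<Longrightarrow> norm (y i) \<le> B" "\<And>i. i \<le> - int I \<Longrightarrow> norm (y i) \<le> B"
proof -
  have lim: "((\<lambda>i. infdist (y i) C) \<longlongrightarrow> 0) at_top" "((\<lambda>i. infdist (y i) C) \<longlongrightarrow> 0) at_bot"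
    using y by (auto simp: homoclinic_to_def)
  have "\<forall>\<^sub>F i in at_top. infdist (y i) C < 1" "\<forall>\<^sub>F i in at_bot. infdist (y i) C < 1"
    using order_tendstoD(2)[OF lim(1), of 1] order_tendstoD(2)[OF lim(2), of 1] by simp_all
  then obtain I1 I2 where I: "\<And>i. i \<ge> I1 \<Longrightarrow> infdist (y i) C < 1" "\<And>i. i \<le> I2 \<Longrightarrow> infdist (y i) C < 1"
    by (auto simp: eventually_at_top_linorder eventually_at_bot_linorder)
  define I where "I = nat (max I1 (- I2))"
  define B where "B = Max (norm ` C) + 1"
  have "norm (y i) \<le> B" if "infdist (y i) C < 1" for i
  proof -
    obtain c where c: "c \<in> C" "infdist (y i) C = dist (y i) c"
      using infdist_attains_inf[of C "y i"] C finite_imp_closed by blast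
    have "norm (y i) \<le> norm c + norm (y i - c)"
      by (rule norm_triangle_sub)
    also have "\<dots> \<le> Max (norm ` C) + 1"
      using c that C by (intro add_mono) (auto simp: dist_norm)
    finally show ?thesis by (simp add: B_def)
  qed
  moreover have "I1 \<le> i" if "i \<ge> int I" for i
    using that by (simp add: I_def max_def split: if_splits)
  moreover have "i \<le> I2" if "i \<le> - int I" for i
    using that by (simp add: I_def max_def split: if_splits)
  ultimately show ?thesis
    using that[of I B] I by blast
qed

lemma letter_map_affine_combination:
  "letter_map A_L A_R b s ((1 - t) *\<^sub>R u + t *\<^sub>R v) =
     (1 - t) *\<^sub>R letter_map A_L A_R b s u + t *\<^sub>R letter_map A_L A_R b s v"
  by (simp add: letter_map_def matrix_vector_right_distrib matrix_vector_mult_scaleR algebra_simps)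

text \<open>
  Both points lie in the same closed half-space, and not both on its boundary.
\<close>
lemma strictly_agrees_convex_combination:
  assumes "agrees_with_sign i1 s u" "agrees_with_sign i1 s v" "\<not> (u $ i1 = 0 \<and> v $ i1 = 0)" "0 < t" "t < 1"
  shows "strictly_agrees i1 s ((1 - t) *\<^sub>R u + t *\<^sub>R v)"
proof (cases s)
  case L
  then have le: "u $ i1 \<le> 0" "v $ i1 \<le> 0"
    using assms by (auto simp: agrees_with_sign_def not_less[symmetric])
  then have "(1 - t) * u $ i1 \<le> 0" "t * v $ i1 \<le> 0" "(1 - t) * u $ i1 < 0 \<or> t * v $ i1 < 0"
    using assms by (auto simp: mult_le_0_iff mult_less_0_iff)
  then show ?thesis
    using L by (auto simp: strictly_agrees_iff)
next
  case R
  then have le: "u $ i1 \<ge> 0" "v $ i1 \<ge> 0"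
    using assms by (auto simp: agrees_with_sign_def not_less[symmetric])
  then have "(1 - t) * u $ i1 \<ge> 0" "t * v $ i1 \<ge> 0" "(1 - t) * u $ i1 > 0 \<or> t * v $ i1 > 0"
    using assms by (auto simp: zero_less_mult_iff)
  then show ?thesis
    using R by (auto simp: strictly_agrees_iff)
qed

section \<open>Two admissible orbits with the same symbols\<close>

text \<open>
  A saddle \<open>X\<close>-cycle with a homoclinic orbit for \<open>X\<^sup>\<infinity> Y X\<^sup>\<infinity>\<close>; \<open>c_det\<close> is the determinant of the \<open>2 \<times> 2\<close>
  compression of the linear part of \<open>f\<^sub>Y\<close>, written out.
\<close>
locale subsumed_homoclinic =
  saddle "word_matrix A_L A_R X" lam1 lam2 C \<gamma> w1 w2 z1 z2
  for A_L A_R :: "real ^ 'n::finite ^ 'n" and X :: "letter list"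
    and lam1 lam2 C \<gamma> :: real and w1 w2 z1 z2 :: "real ^ 'n" +
  fixes i1 :: 'n and b \<xi> :: "real ^ 'n" and Y :: "letter list" and \<alpha> :: nat and c :: real
    and x :: "nat \<Rightarrow> real ^ 'n" and y :: "int \<Rightarrow> real ^ 'n"
  assumes continuity: "A_R = A_L + (\<chi> i j. \<xi> $ i * axis i1 1 $ j)"
    and words: "X @ Y = flip_at \<alpha> (flip_at 0 (Y @ X))"
    and c_det: "c = (w1 \<bullet> (word_matrix A_L A_R Y *v z1)) * (w2 \<bullet> (word_matrix A_L A_R Y *v z2))
                  - (w1 \<bullet> (word_matrix A_L A_R Y *v z2)) * (w2 \<bullet> (word_matrix A_L A_R Y *v z1))"
    and c_bounds: "lam2 < c" "c < 1"
    and X_cycle: "admissible_cycle i1 A_L A_R b X x"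
      "cycle_points X x \<inter> switching_manifold i1 = {}"
    and orbit: "admissible_orbit i1 A_L A_R b (homoclinic_sequence X Y) y"
      "homoclinic_to (cycle_points X x) y"
    and on_sigma: "y 0 $ i1 = 0" "y (int \<alpha>) $ i1 = 0"
    and no_repeat: "\<And>i. i \<ge> 0 \<Longrightarrow> \<not> (y i $ i1 = 0 \<and> y (i + int (length X)) $ i1 = 0)"
begin

abbreviation f_word :: "letter list \<Rightarrow> real ^ 'n \<Rightarrow> real ^ 'n" where
  "f_word \<equiv> word_map A_L A_R b"

abbreviation S :: "int \<Rightarrow> letter" where
  "S \<equiv> homoclinic_sequence X Y"

abbreviation Q :: "real ^ 'n ^ 'n" where
  "Q \<equiv> word_matrix A_L A_R Y"

definition g :: "real ^ 'n" where
  "g = f_word Y (x 0) - x 0"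

definition a :: real where
  "a = w1 \<bullet> (y 0 - x 0)"

text \<open>
  For the empty word the matrix is the identity, whose only eigenvalue is 1.
\<close>
lemma X_nonempty: "X \<noteq> []"
proof
  assume "X = []"
  then show False
    using w_M(1)[of z1] lam normalised by simp
qed

lemma X_cycle_point: "r \<le> length X \<Longrightarrow> f_word (take r X) (x 0) = x (r mod length X)"
proof (induction r)
  case (Suc r)
  then have "f_word (take (Suc r) X) (x 0) = letter_map A_L A_R b (X ! r) (x r)"
    by (simp add: word_map_take_Suc)
  also have "\<dots> = x (Suc r mod length X)"
    using X_cycle(1) Suc.prems by (simp add: admissible_cycle_def is_cycle_def)
  finally show ?case .
qed simp

lemma X_fixed: "f_word X (x 0) = x 0"
  using X_cycle_point[of "length X"] by simp

lemma X_cycle_strict: "r < length X \<Longrightarrow> strictly_agrees i1 (X ! r) (x r)"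
proof -
  have off: "x r $ i1 \<noteq> 0" if "r < length X" for r
    using X_cycle(2) that by (auto simp: cycle_points_def switching_manifold_def)
  have fol: "agrees_with_sign i1 (X ! r) ((pwl_map i1 A_L A_R b ^^ r) (x 0))" if "r < length X" for r
    using X_cycle(1) that by (auto simp: admissible_cycle_def follows_def)
  have "(pwl_map i1 A_L A_R b ^^ r) (x 0) = x r" if "r < length X" for r
    using that
  proof (induction r)
    case (Suc r)
    then have r: "r < length X" and IH: "(pwl_map i1 A_L A_R b ^^ r) (x 0) = x r"
      by simp_all
    then have "strictly_agrees i1 (X ! r) (x r)"
      using fol[OF r] off[OF r] by (simp add: strictly_agrees_def)
    then have "(pwl_map i1 A_L A_R b ^^ Suc r) (x 0) = letter_map A_L A_R b (X ! r) (x r)"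
      by (simp add: IH pwl_map_eq_letter_map)
    also have "\<dots> = x (Suc r)"
      using X_cycle(1) Suc.prems by (simp add: admissible_cycle_def is_cycle_def)
    finally show ?case .
  qed simp
  then show "r < length X \<Longrightarrow> strictly_agrees i1 (X ! r) (x r)"
    using fol off by (simp add: strictly_agrees_def)
qed

lemma f_X: "f_word X (x 0 + d) = x 0 + word_matrix A_L A_R X *v d"
  by (simp add: word_map_add X_fixed)

lemma f_X_power: "(f_word X ^^ k) (x 0 + d) = x 0 + T k d"
  by (induction k) (simp_all add: f_X)

lemma f_Y: "f_word Y (x 0 + d) = x 0 + (g + Q *v d)"
  by (simp add: word_map_add g_def)

lemma S_orbit_backward:
  assumes "is_orbit A_L A_R b S u" "r \<le> length X"
  shows "u (int r - int (Suc j * length X)) = f_word (take r X) (u (- int (Suc j * length X)))"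
  using orbit_along_word[OF assms(1), of X "- int (Suc j * length X)" r]
    homoclinic_sequence_neg[of _ X Y j] assms(2)
  by (simp only: add.commute[of _ "int _"] uminus_add_conv_diff[symmetric] diff_conv_add_uminus)

lemma S_orbit_backward_step:
  assumes "is_orbit A_L A_R b S u"
  shows "u (- int (j * length X)) = f_word X (u (- int (Suc j * length X)))"
  using S_orbit_backward[OF assms, of "length X" j] by simp

lemma S_orbit_middle:
  assumes "is_orbit A_L A_R b S u" "r \<le> length Y"
  shows "u (int r) = f_word (take r Y) (u 0)"
  using orbit_along_word[OF assms(1), of Y 0 r] homoclinic_sequence_middle[of _ Y X] assms(2)
  by simp

lemma S_orbit_forward:
  assumes "is_orbit A_L A_R b S u" "r \<le> length X"
  shows "u (int (length Y) + int (j * length X) + int r) =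
    f_word (take r X) (u (int (length Y) + int (j * length X)))"
  using orbit_along_word[OF assms(1), of X "int (length Y) + int (j * length X)" r]
    homoclinic_sequence_pos[of _ X Y j] assms(2)
  by blast

lemma S_orbit_forward_power:
  assumes "is_orbit A_L A_R b S u"
  shows "u (int (length Y) + int (j * length X)) = (f_word X ^^ j) (u (int (length Y)))"
proof (induction j)
  case (Suc j)
  have "int (length Y) + int (Suc j * length X) = int (length Y) + int (j * length X) + int (length X)"
    by simp
  then show ?case
    using S_orbit_forward[OF assms, of "length X" j] Suc by (simp add: ac_simps)
qed simp

lemma y_orbit: "is_orbit A_L A_R b S y" "\<And>i. agrees_with_sign i1 (S i) (y i)"
  using orbit(1) by (auto simp: admissible_orbit_def)

lemma y_bounded: "\<exists>B I. (\<forall>i\<ge>int I. norm (y i) \<le> B) \<and> (\<forall>i\<le>- int I. norm (y i) \<le> B)"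
proof -
  have "finite (cycle_points X x)" "cycle_points X x \<noteq> {}"
    using X_nonempty by (auto simp: cycle_points_def lessThan_empty_iff)
  from homoclinic_orbit_bounded[OF this orbit(2)] show ?thesis
    by metis
qed

lemma le_mult_length_X: "i \<le> j \<Longrightarrow> int i \<le> int (j * length X)"
proof -
  assume "i \<le> j"
  moreover have "1 \<le> length X"
    using X_nonempty by (simp add: Suc_le_eq)
  ultimately have "i * 1 \<le> j * length X"
    by (rule mult_le_mono)
  then show "int i \<le> int (j * length X)"
    by (simp only: of_nat_le_iff mult_1_right)
qed

text \<open>
  The backward orbit of \<open>f\<^sub>X\<close> through \<open>y 0\<close> is bounded, hence it lies on the unstable line.
\<close>
lemma y_backward: "y (- int (j * length X)) = x 0 + (a / lam1 ^ j) *\<^sub>R z1"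
proof -
  define d where "d j = y (- int (j * length X)) - x 0" for j
  have step: "word_matrix A_L A_R X *v d (Suc j) = d j" for j
    using f_X[of "d (Suc j)"] S_orbit_backward_step[OF y_orbit(1), of j] by (simp add: d_def)
  obtain B I where B: "\<And>i. i \<le> - int I \<Longrightarrow> norm (y i) \<le> B"
    using y_bounded by metis
  have bdd: "norm (d j) \<le> B + norm (x 0)" if "j \<ge> I" for j
  proof -
    have "norm (y (- int (j * length X))) \<le> B"
      using le_mult_length_X[OF that] by (intro B) linarith
    then show ?thesis
      using norm_triangle_ineq4[of "y (- int (j * length X))" "x 0"] by (simp add: d_def)
  qed
  have "d j = (w1 \<bullet> d 0 / lam1 ^ j) *\<^sub>R z1"
    by (rule bounded_backward_orbit[where I = I and B = "B + norm (x 0)"]) (fact step, fact bdd)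
  moreover have "y (- int (j * length X)) = x 0 + d j" "w1 \<bullet> d 0 = a"
    by (simp_all add: d_def a_def)
  ultimately show ?thesis
    by (simp only:)
qed

text \<open>
  The forward orbit of \<open>f\<^sub>X\<close> through \<open>y (length Y)\<close> is bounded, hence it starts in the stable hyperplane.
\<close>
lemma y_p_stable: "w1 \<bullet> (y (int (length Y)) - x 0) = 0"
proof -
  let ?d = "y (int (length Y)) - x 0"
  obtain B I where B: "\<And>i. i \<ge> int I \<Longrightarrow> norm (y i) \<le> B"
    using y_bounded by metis
  have bdd: "norm (T k ?d) \<le> B + norm (x 0)" if "k \<ge> I" for k
  proof -
    have "norm (y (int (length Y) + int (k * length X))) \<le> B"
      using le_mult_length_X[OF that] by (intro B) linarith
    moreover have "T k ?d = y (int (length Y) + int (k * length X)) - x 0"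
      using f_X_power[of k ?d] S_orbit_forward_power[OF y_orbit(1), of k] by simp
    ultimately show ?thesis
      using norm_triangle_ineq4[of "y (int (length Y) + int (k * length X))" "x 0"] by simp
  qed
  show ?thesis
    by (rule bounded_forward_orbit[where K = I and B = "B + norm (x 0)"]) (fact bdd)
qed

lemma a_nonzero: "a \<noteq> 0"
proof
  assume "a = 0"
  then have "y 0 = x 0"
    using y_backward[of 0] by simp
  then show False
    using on_sigma(1) X_cycle_strict[of 0] X_nonempty by (simp add: strictly_agrees_def)
qed

text \<open>
  The same orbit one period of \<open>X\<close> later. It is a second orbit with the symbols of \<open>y\<close>: the symbols
  change under the shift only at two indices, where the shifted orbit is on the switching manifold and every
  symbol is admissible.
\<close>
definition y_next :: "int \<Rightarrow> real ^ 'n" where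
  "y_next i = y (i + int (length X))"

lemma y_next_orbit: "is_orbit A_L A_R b S y_next" "agrees_with_sign i1 (S i) (y_next i)"
proof -
  have shift: "S (i + int (length X)) = S i \<or> y_next i $ i1 = 0" for i
    using homoclinic_sequence_shift[OF words, of i] on_sigma by (fastforce simp: y_next_def)
  show "is_orbit A_L A_R b S y_next"
    unfolding is_orbit_def
  proof
    fix i
    have "y_next (i + 1) = letter_map A_L A_R b (S (i + int (length X))) (y_next i)"
      using y_orbit(1)[unfolded is_orbit_def, rule_format, of "i + int (length X)"]
      by (simp add: y_next_def ac_simps)
    then show "y_next (i + 1) = letter_map A_L A_R b (S i) (y_next i)"
      using shift[of i] letter_map_on_switching_manifold[OF continuity] by metis
  qed
  show "agrees_with_sign i1 (S i) (y_next i)"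
    using shift[of i] y_orbit(2)[of "i + int (length X)"] by (auto simp: y_next_def agrees_with_sign_def)
qed

lemma y_next_backward: "y_next (- int (j * length X)) = x 0 + (lam1 * a / lam1 ^ j) *\<^sub>R z1"
proof (cases j)
  case 0
  have "y_next 0 = f_word X (y 0)"
    using S_orbit_backward_step[OF y_next_orbit(1), of 0] by (simp add: y_next_def)
  then show ?thesis
    using y_backward[of 0] 0 by (simp add: f_X matrix_vector_mult_scaleR M_z mult.commute)
next
  case (Suc i)
  then show ?thesis
    using y_backward[of i] lam by (simp add: y_next_def)
qed

text \<open>
  The points \<open>x 0 + a z1\<close> and \<open>x 0 + (lam1 * a) z1\<close> of \<open>y\<close> and \<open>y_next\<close> at time 0 have images \<open>p\<close> and
  \<open>f\<^sub>X p\<close> under \<open>f\<^sub>Y\<close>, where \<open>p\<close> is in the stable hyperplane. Two points determine the affine map on the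
  unstable line.
\<close>
lemma global_map_relations:
  "w1 \<bullet> (Q *v z1) = 0" "w1 \<bullet> g = 0" "w2 \<bullet> g = - (1 + lam1) * a * (w2 \<bullet> (Q *v z1))"
proof -
  have y0: "y 0 = x 0 + a *\<^sub>R z1" "y_next 0 = x 0 + (lam1 * a) *\<^sub>R z1"
    using y_backward[of 0] y_next_backward[of 0] by simp_all
  have yp: "y (int (length Y)) = x 0 + (g + a *\<^sub>R (Q *v z1))"
    using S_orbit_middle[OF y_orbit(1), of "length Y"] by (simp add: y0 f_Y matrix_vector_mult_scaleR)
  have "y_next (int (length Y)) = x 0 + (g + (lam1 * a) *\<^sub>R (Q *v z1))"
    using S_orbit_middle[OF y_next_orbit(1), of "length Y"] by (simp add: y0 f_Y matrix_vector_mult_scaleR)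
  moreover have "y_next (int (length Y)) = f_word X (y (int (length Y)))"
    using S_orbit_forward_power[OF y_orbit(1), of 1] by (simp add: y_next_def)
  ultimately have eq: "g + (lam1 * a) *\<^sub>R (Q *v z1) = word_matrix A_L A_R X *v (g + a *\<^sub>R (Q *v z1))"
    unfolding yp f_X by simp
  have 1: "w1 \<bullet> g + a * (w1 \<bullet> (Q *v z1)) = 0"
    using y_p_stable by (simp add: yp inner_add_right)
  have "w1 \<bullet> g + lam1 * a * (w1 \<bullet> (Q *v z1)) = 0"
    using arg_cong[OF eq, of "inner w1"] 1 by (simp add: w_M inner_add_right)
  moreover have "(lam1 - 1) * (a * (w1 \<bullet> (Q *v z1))) =
      (w1 \<bullet> g + lam1 * a * (w1 \<bullet> (Q *v z1))) - (w1 \<bullet> g + a * (w1 \<bullet> (Q *v z1)))"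
    by (simp add: algebra_simps)
  ultimately have "(lam1 - 1) * (a * (w1 \<bullet> (Q *v z1))) = 0"
    using 1 by simp
  then show Q11: "w1 \<bullet> (Q *v z1) = 0"
    using a_nonzero lam by simp
  then show "w1 \<bullet> g = 0"
    using 1 by simp
  have "w2 \<bullet> g + lam1 * a * (w2 \<bullet> (Q *v z1)) = lam2 * (w2 \<bullet> g + a * (w2 \<bullet> (Q *v z1)))"
    using arg_cong[OF eq, of "inner w2"] by (simp add: w_M inner_add_right)
  then have "lam1 * (w2 \<bullet> g + lam1 * a * (w2 \<bullet> (Q *v z1))) = lam1 * lam2 * (w2 \<bullet> g + a * (w2 \<bullet> (Q *v z1)))"
    by simp
  then have "(lam1 - 1) * (w2 \<bullet> g + (1 + lam1) * a * (w2 \<bullet> (Q *v z1))) = 0"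
    using lam(4) by (simp add: algebra_simps)
  then have "w2 \<bullet> g + (1 + lam1) * a * (w2 \<bullet> (Q *v z1)) = 0"
    using lam by simp
  then show "w2 \<bullet> g = - (1 + lam1) * a * (w2 \<bullet> (Q *v z1))"
    by (simp add: algebra_simps)
qed

lemma c_product: "c = - (w1 \<bullet> (Q *v z2)) * (w2 \<bullet> (Q *v z1))"
  using c_det global_map_relations(1) by simp

text \<open>
  The parameter of \<open>u\<close> in the segment from \<open>a\<close> to \<open>lam1 * a\<close>.
\<close>
definition \<theta> :: real where
  "\<theta> = (c * (1 + lam1) / (1 + c) - 1) / (lam1 - 1)"

text \<open>
  The limit of the \<open>z1\<close>-component of the \<open>X\<^sup>k Y\<close>-cycles just before \<open>Y\<close>.
\<close>
definition u :: real where
  "u = c * (1 + lam1) / (1 + c) * a"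

lemma c_pos: "0 < c"
  using c_bounds lam by simp

text \<open>
  Here \<open>lam2 < c\<close> is used in the form \<open>1 < lam1 * c\<close>.
\<close>
lemma \<theta>_bounds: "0 < \<theta>" "\<theta> < 1"
proof -
  have "lam1 * lam2 < lam1 * c"
    using c_bounds lam by (intro mult_strict_left_mono) auto
  then have "1 < lam1 * c"
    using lam by simp
  then have "1 < c * (1 + lam1) / (1 + c)"
    using c_pos by (simp add: pos_less_divide_eq algebra_simps)
  then show "0 < \<theta>"
    using lam by (simp add: \<theta>_def)
  have "c < lam1"
    using c_bounds lam by simp
  then have "c * (1 + lam1) / (1 + c) < lam1"
    using c_pos by (simp add: pos_divide_less_eq algebra_simps)
  then show "\<theta> < 1"
    using lam by (simp add: \<theta>_def pos_divide_less_eq)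
qed

lemma u_between: "(1 - \<theta>) * a + \<theta> * (lam1 * a) = u"
proof -
  have "\<theta> * (lam1 - 1) = c * (1 + lam1) / (1 + c) - 1"
    using lam by (simp add: \<theta>_def)
  then have "u = (1 + \<theta> * (lam1 - 1)) * a"
    by (simp add: u_def)
  then show ?thesis
    by (simp add: algebra_simps)
qed

text \<open>
  The orbit that the \<open>X\<^sup>k Y\<close>-cycles converge to. It is an orbit because the maps are affine.
\<close>
definition v :: "int \<Rightarrow> real ^ 'n" where
  "v i = (1 - \<theta>) *\<^sub>R y i + \<theta> *\<^sub>R y_next i"

lemma v_orbit: "is_orbit A_L A_R b S v"
  using y_orbit(1) y_next_orbit(1) by (simp add: is_orbit_def v_def letter_map_affine_combination)

text \<open>
  At a negative time both points lie on a line through a point \<open>x r\<close> of the \<open>X\<close>-cycle, at parameters \<open>s\<close>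
  and \<open>lam1 s\<close>. If both were on the switching manifold, so would be \<open>x r\<close>.
\<close>
lemma not_both_on_sigma: "\<not> (y i $ i1 = 0 \<and> y_next i $ i1 = 0)"
proof (cases "i \<ge> 0")
  case True
  then show ?thesis
    using no_repeat by (simp add: y_next_def)
next
  case False
  let ?n = "length X"
  have n: "0 < ?n"
    using X_nonempty by simp
  \<comment> \<open>The block of \<open>X\<close> that contains \<open>i\<close> starts at \<open>- (j + 1) n\<close>, and \<open>i\<close> is its \<open>r\<close>-th index.\<close>
  define r where "r = nat (i mod int ?n)"
  define j where "j = nat (- (i div int ?n)) - 1"
  have r: "r < ?n"
    using n by (simp add: r_def nat_less_iff)
  have "i div int ?n < 0"
    using False n by (simp add: pos_imp_zdiv_neg_iff)
  then have j: "int (Suc j) = - (i div int ?n)"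
    by (simp add: j_def)
  have "i = int r - int (Suc j) * int ?n"
    unfolding j using n div_mult_mod_eq[of i "int ?n"] by (simp add: r_def)
  then have i: "i = int r - int (Suc j * ?n)"
    by (simp only: of_nat_mult)
  let ?q = "word_matrix A_L A_R (take r X) *v z1"
  have xr: "f_word (take r X) (x 0) = x r"
    using X_cycle_point[of r] r by simp
  have "y i = x r + (a / lam1 ^ Suc j) *\<^sub>R ?q"
    unfolding i S_orbit_backward[OF y_orbit(1) less_imp_le[OF r]] y_backward
    by (simp add: word_map_add xr matrix_vector_mult_scaleR)
  moreover have "y_next i = x r + (lam1 * a / lam1 ^ Suc j) *\<^sub>R ?q"
    unfolding i S_orbit_backward[OF y_next_orbit(1) less_imp_le[OF r]] y_next_backward
    by (simp add: word_map_add xr matrix_vector_mult_scaleR)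
  moreover have "x r $ i1 \<noteq> 0"
    using X_cycle_strict[OF r] by (simp add: strictly_agrees_def)
  moreover define s where "s = a / lam1 ^ Suc j * ?q $ i1"
  ultimately have "y i $ i1 = x r $ i1 + s" "y_next i $ i1 = x r $ i1 + lam1 * s"
    by simp_all
  moreover have "\<not> (e + s = 0 \<and> e + lam1 * s = 0)" if "e \<noteq> 0" for e
  proof
    assume e: "e + s = 0 \<and> e + lam1 * s = 0"
    have "(lam1 - 1) * s = (e + lam1 * s) - (e + s)"
      by (simp add: algebra_simps)
    then have "(lam1 - 1) * s = 0" "e = - s"
      using e by (simp_all add: eq_neg_iff_add_eq_0)
    then show False
      using that lam by simp
  qed
  ultimately show ?thesis
    using \<open>x r $ i1 \<noteq> 0\<close> by simp
qed

lemma v_strict: "strictly_agrees i1 (S i) (v i)"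
  unfolding v_def
  by (rule strictly_agrees_convex_combination[OF y_orbit(2) y_next_orbit(2) not_both_on_sigma \<theta>_bounds])

lemma v_backward: "v (- int (j * length X)) = x 0 + (u / lam1 ^ j) *\<^sub>R z1"
proof -
  have "v (- int (j * length X)) = x 0 + (((1 - \<theta>) * a + \<theta> * (lam1 * a)) / lam1 ^ j) *\<^sub>R z1"
    unfolding v_def y_backward y_next_backward by (simp add: algebra_simps add_divide_distrib diff_divide_distrib)
  then show ?thesis
    by (simp only: u_between)
qed

lemma v_forward: "v (int (length Y) + int (j * length X)) = x 0 + T j (g + u *\<^sub>R (Q *v z1))"
proof -
  have "v 0 = x 0 + u *\<^sub>R z1"
    using v_backward[of 0] by simp
  then have "v (int (length Y)) = x 0 + (g + u *\<^sub>R (Q *v z1))"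
    using S_orbit_middle[OF v_orbit, of "length Y"] by (simp add: f_Y matrix_vector_mult_scaleR)
  then show ?thesis
    using S_orbit_forward_power[OF v_orbit, of j] by (simp only: f_X_power)
qed

section \<open>The stable cycles\<close>

lemma word_points:
  assumes strictX: "\<And>j r. j < k \<Longrightarrow> r < length X \<Longrightarrow> strictly_agrees i1 (X ! r) (f_word (take r X) (x 0 + T j h))"
    and strictY: "\<And>r. r < length Y \<Longrightarrow> strictly_agrees i1 (Y ! r) (f_word (take r Y) (x 0 + T k h))"
    and i: "i < length (word_power X k @ Y)"
  shows "strictly_agrees i1 ((word_power X k @ Y) ! i) (f_word (take i (word_power X k @ Y)) (x 0 + h))"
proof (cases "i < k * length X")
  case True
  define j where "j = i div length X"
  define r where "r = i mod length X"
  have r: "r < length X"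
    using X_nonempty by (simp add: r_def)
  have j: "j < k"
    using True by (simp add: j_def less_mult_imp_div_less)
  have ir: "i = length (word_power X j) + r"
    by (simp add: length_word_power j_def r_def)
  have W: "word_power X k @ Y = word_power X j @ X @ word_power X (k - Suc j) @ Y"
    using word_power_split[OF j, of X] by simp
  have "(word_power X k @ Y) ! i = X ! r" "take i (word_power X k @ Y) = word_power X j @ take r X"
    unfolding W ir using r by (simp_all add: nth_append)
  then show ?thesis
    using strictX[OF j r] by (simp add: word_map_append word_map_power f_X_power)
next
  case False
  define r where "r = i - k * length X"
  have r: "r < length Y" and ir: "i = length (word_power X k) + r"
    using False i by (auto simp: r_def length_word_power)
  then have "(word_power X k @ Y) ! i = Y ! r" "take i (word_power X k @ Y) = word_power X k @ take r Y"
    by simp_all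
  then show ?thesis
    using strictY[OF r] by (simp add: word_map_append word_map_power f_X_power)
qed

text \<open>
  The contraction concerns \<open>M\<^sup>k Q\<close>, the return map to the point before \<open>Y\<close>. The cycle starts after \<open>Y\<close>
  with linear part \<open>Q M\<^sup>k\<close>, whose powers are \<open>Q (M\<^sup>k Q)\<^sup>j M\<^sup>k\<close>.
\<close>
lemma word_matrix_cycle_decay:
  assumes \<rho>: "0 < \<rho>" "\<rho> < 1" and B: "0 \<le> B"
    and decay: "\<And>j d. norm (((\<lambda>d. T k (Q *v d)) ^^ j) d) \<le> B * \<rho> ^ j * norm d"
  shows "\<exists>B'\<ge>0. \<forall>j d. norm (((*v) (word_matrix A_L A_R (word_power X k @ Y)) ^^ j) d) \<le> B' * \<rho> ^ j * norm d"
proof -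
  let ?R = "(*v) (word_matrix A_L A_R (word_power X k @ Y))"
  let ?L = "\<lambda>d. T k (Q *v d)"
  have R: "?R d = Q *v T k d" for d
    by (simp add: word_matrix_append matrix_vector_mul_assoc[symmetric] word_matrix_power)
  have conj: "(?R ^^ Suc j) d = Q *v (?L ^^ j) (T k d)" for j d
    by (induction j) (simp_all add: R)
  obtain K1 where K1: "\<And>d. norm (Q *v d) \<le> K1 * norm d" "K1 > 0"
    using linear_bounded_pos[OF matrix_vector_mul_linear, of Q] by blast
  obtain K2 where K2: "\<And>d. norm (T k d) \<le> K2 * norm d" "K2 > 0"
    using linear_bounded_pos[OF T_linear[of k]] by blast
  define B' where "B' = 1 + K1 * B * K2 / \<rho>"
  have B': "1 \<le> B'" "K1 * B * K2 / \<rho> \<le> B'"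
    using K1(2) K2(2) B \<rho> by (simp_all add: B'_def)
  have "norm ((?R ^^ j) d) \<le> B' * \<rho> ^ j * norm d" for j d
  proof (cases j)
    case 0
    then show ?thesis
      using B'(1) mult_right_mono[OF B'(1), of "norm d"] by simp
  next
    case (Suc m)
    have "norm ((?R ^^ j) d) \<le> K1 * norm ((?L ^^ m) (T k d))"
      unfolding Suc conj by (rule K1)
    also have "\<dots> \<le> K1 * (B * \<rho> ^ m * (K2 * norm d))"
      using K1(2) B \<rho> by (intro mult_left_mono order_trans[OF decay] K2) auto
    also have "\<dots> = (K1 * B * K2 / \<rho>) * (\<rho> ^ j * norm d)"
      using \<rho> by (simp add: Suc field_simps)
    also have "\<dots> \<le> B' * (\<rho> ^ j * norm d)"
      using \<rho> by (intro mult_right_mono B') auto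
    finally show ?thesis
      by (simp add: mult.assoc)
  qed
  then show ?thesis
    using B'(1) by (intro exI[of _ B']) auto
qed

lemma open_strict_word: "open {d. \<forall>r<length Z. strictly_agrees i1 (Z ! r) (f_word (take r Z) (x 0 + d))}"
proof -
  have "open ((\<lambda>d. f_word (take r Z) (x 0 + d)) -` {p. strictly_agrees i1 (Z ! r) p})" for r
    by (intro open_vimage open_strictly_agrees continuous_on_compose2[OF continuous_on_word_map[of UNIV]]
        continuous_intros) auto
  then have "open (\<Inter>r\<in>{..<length Z}. (\<lambda>d. f_word (take r Z) (x 0 + d)) -` {p. strictly_agrees i1 (Z ! r) p})"
    by (intro open_INT) auto
  moreover have "(\<Inter>r\<in>{..<length Z}. (\<lambda>d. f_word (take r Z) (x 0 + d)) -` {p. strictly_agrees i1 (Z ! r) p})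
      = {d. \<forall>r<length Z. strictly_agrees i1 (Z ! r) (f_word (take r Z) (x 0 + d))}"
    by auto
  ultimately show ?thesis
    by simp
qed

text \<open>
  The points of the cycle in the \<open>X\<close>-blocks are controlled by an open set of points whose next \<open>length X\<close>
  symbols are strictly those of \<open>X\<close>, and the points in the \<open>Y\<close>-block by the analogous set for \<open>Y\<close>. The limit
  orbit and the \<open>X\<close>-cycle provide the points of these sets.
\<close>
lemma eventually_stable_cycle:
  "\<forall>\<^sub>F k in sequentially. \<exists>z. admissible_cycle i1 A_L A_R b (word_power X k @ Y) z \<and>
     asymptotically_stable (pwl_map i1 A_L A_R b) (z 0) \<and>
     cycle_points (word_power X k @ Y) z \<inter> switching_manifold i1 = {}"
proof -
  from return_map_fixed_points[OF global_map_relations(1,2) c_product c_pos c_bounds(2)]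
  obtain d K where dK: "(\<forall>k\<ge>K. T k (g + Q *v d k) = d k) \<and>
     d \<longlonglongrightarrow> (w1 \<bullet> (Q *v z2) * (w2 \<bullet> g) / (1 + c)) *\<^sub>R z1 \<and>
     (\<forall>k\<ge>K. \<exists>B \<rho>. 0 < \<rho> \<and> \<rho> < 1 \<and> 0 \<le> B \<and>
       (\<forall>j v. norm (((\<lambda>v. T k (Q *v v)) ^^ j) v) \<le> B * \<rho> ^ j * norm v))"
    by (elim exE) (rule that)
  note d = dK[THEN conjunct1, rule_format]
    and d_lim' = dK[THEN conjunct2, THEN conjunct1]
    and decay = dK[THEN conjunct2, THEN conjunct2, rule_format]
  have "w1 \<bullet> (Q *v z2) * (w2 \<bullet> g) = c * (1 + lam1) * a"
    by (simp add: global_map_relations(3) c_product algebra_simps)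
  then have d_lim: "d \<longlonglongrightarrow> u *\<^sub>R z1"
    using d_lim' by (simp add: u_def)
  define h where "h k = g + Q *v d k" for k
  define h0 where "h0 = g + u *\<^sub>R (Q *v z1)"
  have h_lim: "h \<longlonglongrightarrow> h0"
  proof -
    have "(\<lambda>k. Q *v d k) \<longlonglongrightarrow> Q *v (u *\<^sub>R z1)"
      using linear_continuous_at[OF linear_conv_bounded_linear[THEN iffD1, OF matrix_vector_mul_linear]] d_lim
      by (rule isCont_tendsto_compose)
    then show ?thesis
      unfolding h_def h0_def by (intro tendsto_intros) (simp add: matrix_vector_mult_scaleR)
  qed
  have T_h: "T k (h k) = d k" if "k \<ge> K" for k
    using d[OF that] by (simp add: h_def)
  have T_h_lim: "(\<lambda>k. T k (h k)) \<longlonglongrightarrow> u *\<^sub>R z1"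
  proof (rule Lim_transform_eventually[OF d_lim])
    show "\<forall>\<^sub>F k in sequentially. d k = T k (h k)"
      using eventually_ge_at_top[of K] by eventually_elim (simp add: T_h)
  qed
  define GX where "GX = {d. \<forall>r<length X. strictly_agrees i1 (X ! r) (f_word (take r X) (x 0 + d))}"
  define GY where "GY = {d. \<forall>r<length Y. strictly_agrees i1 (Y ! r) (f_word (take r Y) (x 0 + d))}"
  have "0 \<in> GX"
    using X_cycle_strict X_cycle_point by (simp add: GX_def)
  moreover have "T j h0 \<in> GX" for j
    unfolding GX_def h0_def
  proof (intro CollectI allI impI)
    fix r assume r: "r < length X"
    show "strictly_agrees i1 (X ! r) (f_word (take r X) (x 0 + T j (g + u *\<^sub>R (Q *v z1))))"
      using v_strict[of "int (length Y) + int (j * length X) + int r"]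
        S_orbit_forward[OF v_orbit less_imp_le[OF r], of j] homoclinic_sequence_pos[OF r, of Y j]
      by (simp only: v_forward)
  qed
  moreover have "(u / lam1 ^ i) *\<^sub>R z1 \<in> GX" if i: "i > 0" for i
    unfolding GX_def
  proof (intro CollectI allI impI)
    fix r assume r: "r < length X"
    obtain j where j: "i = Suc j"
      using i gr0_conv_Suc by blast
    show "strictly_agrees i1 (X ! r) (f_word (take r X) (x 0 + (u / lam1 ^ i) *\<^sub>R z1))"
      using v_strict[of "int r - int (Suc j * length X)"]
        S_orbit_backward[OF v_orbit less_imp_le[OF r], of j] homoclinic_sequence_neg[OF r, of Y j]
      by (simp only: v_backward j)
  qed
  ultimately have evX: "\<forall>\<^sub>F k in sequentially. \<forall>j<k. T j (h k) \<in> GX"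
    using open_strict_word h_lim T_h_lim by (intro return_orbit_in_open_set) (auto simp: GX_def)
  have "u *\<^sub>R z1 \<in> GY"
    unfolding GY_def
  proof (intro CollectI allI impI)
    fix r assume r: "r < length Y"
    show "strictly_agrees i1 (Y ! r) (f_word (take r Y) (x 0 + u *\<^sub>R z1))"
      using v_strict[of "int r"] S_orbit_middle[OF v_orbit less_imp_le[OF r]]
        homoclinic_sequence_middle[OF r, of X] v_backward[of 0]
      by simp
  qed
  moreover have "open GY"
    unfolding GY_def by (rule open_strict_word)
  ultimately have evY: "\<forall>\<^sub>F k in sequentially. T k (h k) \<in> GY"
    using topological_tendstoD[OF T_h_lim] by blast
  show ?thesis
    using evX evY eventually_ge_at_top[of K] eventually_ge_at_top[of 1]
  proof eventually_elim
    case (elim k)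
    let ?W = "word_power X k @ Y"
    let ?z = "x 0 + h k"
    have W: "?W \<noteq> []"
    proof -
      have "0 < length ?W"
        using elim(4) X_nonempty by (simp add: length_word_power)
      then show ?thesis
        by (rule length_greater_0_conv[THEN iffD1])
    qed
    have fixed: "f_word ?W ?z = ?z"
      by (simp add: word_map_append word_map_power f_X_power T_h[OF elim(3)] f_Y) (simp add: h_def)
    have strict: "strictly_agrees i1 (?W ! i) (f_word (take i ?W) ?z)" if "i < length ?W" for i
      using elim(1,2) that by (intro word_points) (auto simp: GX_def GY_def)
    obtain B \<rho> where \<rho>: "0 < \<rho>" "\<rho> < 1" "0 \<le> B"
      and B: "\<And>j v. norm (((\<lambda>v. T k (Q *v v)) ^^ j) v) \<le> B * \<rho> ^ j * norm v"
      using decay[OF elim(3)] by blast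
    obtain B' where B': "0 \<le> B'"
      "\<And>j d. norm (((*v) (word_matrix A_L A_R ?W) ^^ j) d) \<le> B' * \<rho> ^ j * norm d"
      using word_matrix_cycle_decay[OF \<rho> B] by blast
    have "asymptotically_stable (pwl_map i1 A_L A_R b) ?z"
      by (rule strict_cycle_asymptotically_stable[OF W fixed strict less_imp_le[OF \<rho>(1)] \<rho>(2) B'])
    then show ?case
      using strict_cycle[OF fixed strict] by (intro exI[of _ "\<lambda>i. f_word (take i ?W) ?z"]) simp
  qed
qed

end

lemma det_two_by_two_compression:
  fixes w1 w2 z1 z2 :: "real ^ 'n::finite" and A :: "real ^ 'n ^ 'n"
  shows "det ((vector [w1, w2] :: real ^ 'n ^ 2) ** A ** transpose (vector [z1, z2] :: real ^ 'n ^ 2)) =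
    (w1 \<bullet> (A *v z1)) * (w2 \<bullet> (A *v z2)) - (w1 \<bullet> (A *v z2)) * (w2 \<bullet> (A *v z1))"
proof -
  have "((U :: real ^ 'n ^ 2) ** A ** transpose (V :: real ^ 'n ^ 2)) $ i $ j = U $ i \<bullet> (A *v V $ j)" for U V i j
    by (simp add: matrix_mul_assoc[symmetric] inner_vec_def)
      (simp add: matrix_matrix_mult_def transpose_def matrix_vector_mult_def)
  then show ?thesis
    by (simp add: det_2)
qed

theorem theorem5p1:
  fixes i1 :: "'n::finite"
    and A_L A_R :: "real ^ 'n ^ 'n"
    and b \<xi> :: "real ^ 'n"
    and X Y :: "letter list"
    and \<alpha> :: nat
    and lam1 lam2 \<beta> c :: real
    and \<omega>1 \<omega>2 \<zeta>1 \<zeta>2 :: "real ^ 'n"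
    and x :: "nat \<Rightarrow> real ^ 'n"
    and y :: "int \<Rightarrow> real ^ 'n"
  assumes continuity: "A_R = A_L + (\<chi> i j. \<xi> $ i * axis i1 1 $ j)"
    and words: "\<alpha> \<in> {1..length X + length Y - 1}"
      "X @ Y = flip_at \<alpha> (flip_at 0 (Y @ X))"
    and eigenvalues:
      "complex_of_real lam1 \<in> complex_eigenvalues (word_matrix A_L A_R X)"
      "complex_of_real lam2 \<in> complex_eigenvalues (word_matrix A_L A_R X)"
      "algebraic_multiplicity (word_matrix A_L A_R X) (complex_of_real lam1) = 1"
      "algebraic_multiplicity (word_matrix A_L A_R X) (complex_of_real lam2) = 1"
      "\<beta> = max_modulus
         (complex_eigenvalues (word_matrix A_L A_R X) - {complex_of_real lam1, complex_of_real lam2})"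
      "0 \<le> \<beta>" "\<beta> < lam2" "lam2 < 1" "1 < lam1"
    and eigenvectors:
      "left_eigenvector (word_matrix A_L A_R X) lam1 \<omega>1"
      "left_eigenvector (word_matrix A_L A_R X) lam2 \<omega>2"
      "right_eigenvector (word_matrix A_L A_R X) lam1 \<zeta>1"
      "right_eigenvector (word_matrix A_L A_R X) lam2 \<zeta>2"
      "\<omega>1 \<bullet> \<zeta>1 = 1" "\<omega>2 \<bullet> \<zeta>2 = 1"
      "\<zeta>1 $ i1 \<noteq> 0"
    and resonance:
      "lam1 * lam2 = 1"
      "c = det ((vector [\<omega>1, \<omega>2] :: real ^ 'n ^ 2) ** word_matrix A_L A_R Y **
                transpose (vector [\<zeta>1, \<zeta>2] :: real ^ 'n ^ 2))"
      "lam2 < c" "c < 1"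
    and X_cycle:
      "admissible_cycle i1 A_L A_R b X x"
      "cycle_points X x \<inter> switching_manifold i1 = {}"
    and homoclinic:
      "admissible_orbit i1 A_L A_R b (homoclinic_sequence X Y) y"
      "homoclinic_to (cycle_points X x) y"
      "unstable_manifold (word_map A_L A_R b X) (x 0) \<inter> switching_manifold i1 = {y 0}"
      "y (int \<alpha>) \<in> switching_manifold i1"
    and no_repeat:
      "\<not> (\<exists>i\<ge>0. y i \<in> switching_manifold i1 \<and> y (i + int (length X)) \<in> switching_manifold i1)"
  shows "\<exists>k_min::nat. \<forall>k\<ge>k_min. \<exists>z.
           admissible_cycle i1 A_L A_R b (word_power X k @ Y) z \<and>
           asymptotically_stable (pwl_map i1 A_L A_R b) (z 0) \<and>
           cycle_points (word_power X k @ Y) z \<inter> switching_manifold i1 = {}"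
proof -
  let ?M = "word_matrix A_L A_R X"
  have distinct: "lam1 \<noteq> lam2"
    using eigenvalues by simp
  obtain C \<gamma> where decay: "0 < \<gamma>" "\<gamma> < lam2" "0 \<le> C"
    "\<And>k d. \<omega>1 \<bullet> d = 0 \<Longrightarrow> \<omega>2 \<bullet> d = 0 \<Longrightarrow> norm (((*v) ?M ^^ k) d) \<le> C * \<gamma> ^ k * norm d"
    using complement_decay[OF eigenvalues(3-7) eigenvectors(1-6)
        left_right_eigenvectors_orthogonal[OF eigenvectors(1,4) distinct]
        left_right_eigenvectors_orthogonal[OF eigenvectors(2,3) distinct[symmetric]]]
    by metis
  have lam2_pos: "0 < lam2"
    using eigenvalues(6,7) by simp
  interpret subsumed_homoclinic A_L A_R X lam1 lam2 C \<gamma> \<omega>1 \<omega>2 \<zeta>1 \<zeta>2 i1 b \<xi> Y \<alpha> c x y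
  proof unfold_locales
    show "y 0 $ i1 = 0"
      using homoclinic(3) by (auto simp: switching_manifold_def)
    show "y (int \<alpha>) $ i1 = 0"
      using homoclinic(4) by (simp add: switching_manifold_def)
    show "\<not> (y i $ i1 = 0 \<and> y (i + int (length X)) $ i1 = 0)" if "i \<ge> 0" for i
      using no_repeat that by (simp add: switching_manifold_def)
    show "c = (\<omega>1 \<bullet> (word_matrix A_L A_R Y *v \<zeta>1)) * (\<omega>2 \<bullet> (word_matrix A_L A_R Y *v \<zeta>2))
        - (\<omega>1 \<bullet> (word_matrix A_L A_R Y *v \<zeta>2)) * (\<omega>2 \<bullet> (word_matrix A_L A_R Y *v \<zeta>1))"
      using resonance(2) by (simp only: det_two_by_two_compression)
  qed (fact lam2_pos assms decay)+
  show ?thesis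
    using eventually_stable_cycle by (simp add: eventually_sequentially)
qed

end
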